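(* Let $Z_1,Z_2,\ldots$ be Banach spaces with the $1$-SEP. Then $(Z_j)_{c_0}$ has the $(2+\varepsilon)$-SEP for all $\varepsilon>0$.
   Context: A Banach space $Z$ has the $\lambda$-SEP ($\lambda$-Separable Extension Property) if for all separable Banach spaces $Y$, all closed linear subspaces $X\subset Y$, and all bounded linear operators $T:X\to Z$, there exists a bounded linear operator $\tilde T:Y\to Z$ extending $T$ with $\|\tilde T\|\le\lambda\|T\|$. For Banach spaces $Z_1,Z_2,\ldots$, $(Z_j)_{c_0}$ is the space of all sequences $(z_j)$ with $z_j\in Z_j$ for all $j$ and $\|z_j\|\to0$, with norm $\|(z_j)\|=\sup_j\|z_j\|$. *)

theory Defs
  imports "HOL-Analysis.Analysis" "HOL-Algebra.Algebraic_Closure_Type"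
begin

text \<open>
  Banach spaces are carrier-based structures: the vector space part is a \<open>module\<close> record of HOL-Algebra
  (whose \<open>mult\<close> and \<open>one\<close> fields play no role for modules), extended by a norm. The scalars are a type
  in the class \<open>real_normed_field\<close>; up to isomorphism the only instances are the real and the
  complex numbers, so both are covered. The class \<open>euclidean_space\<close> holds for both.
\<close>

record ('k, 'a) normed_module = "('k, 'a) module" +
  nrm :: "'a \<Rightarrow> real"

locale normed_vector_space =
  Module.module "ring_of_type_algebra :: 'k ring" E
  for E :: "('k::{real_normed_field, euclidean_space}, 'a) normed_module" (structure) +
  assumes nrm_eq_0_iff: "x \<in> carrier E \<Longrightarrow> nrm E x = 0 \<longleftrightarrow> x = \<zero>"
    and nrm_triangle: "x \<in> carrier E \<Longrightarrow> y \<in> carrier E \<Longrightarrow> nrm E (x \<oplus> y) \<le> nrm E x + nrm E y"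
    and nrm_smult: "x \<in> carrier E \<Longrightarrow> nrm E (a \<odot> x) = norm a * nrm E x"

text \<open>The value outside the carrier is fixed because \<open>Metric_space\<close> requires
  nonnegativity and symmetry of the distance on the whole type.\<close>

definition ndist :: "('k, 'a) normed_module \<Rightarrow> 'a \<Rightarrow> 'a \<Rightarrow> real" where
  "ndist E x y = (if x \<in> carrier E \<and> y \<in> carrier E then nrm E (x \<ominus>\<^bsub>E\<^esub> y) else 0)"

abbreviation ntopology :: "('k, 'a) normed_module \<Rightarrow> 'a topology" where
  "ntopology E \<equiv> Metric_space.mtopology (carrier E) (ndist E)"

definition banach_space :: "('k::{real_normed_field, euclidean_space}, 'a) normed_module \<Rightarrow> bool" where
  "banach_space E \<longleftrightarrow> normed_vector_space E \<and> Metric_space.mcomplete (carrier E) (ndist E)"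

definition closed_subspace ::
  "'a set \<Rightarrow> ('k::{real_normed_field, euclidean_space}, 'a) normed_module \<Rightarrow> bool" where
  "closed_subspace V E \<longleftrightarrow> submodule V (ring_of_type_algebra :: 'k ring) E \<and> closedin (ntopology E) V"

definition bounded_operator ::
  "('k, 'a) normed_module \<Rightarrow> ('k, 'b) normed_module \<Rightarrow> ('a \<Rightarrow> 'b) \<Rightarrow> bool" where
  "bounded_operator E F T \<longleftrightarrow>
     T \<in> carrier E \<rightarrow> carrier F \<and>
     (\<forall>x\<in>carrier E. \<forall>y\<in>carrier E. T (x \<oplus>\<^bsub>E\<^esub> y) = T x \<oplus>\<^bsub>F\<^esub> T y) \<and>
     (\<forall>a. \<forall>x\<in>carrier E. T (a \<odot>\<^bsub>E\<^esub> x) = a \<odot>\<^bsub>F\<^esub> T x) \<and>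
     (\<exists>K. \<forall>x\<in>carrier E. nrm F (T x) \<le> K * nrm E x)"

definition opnorm ::
  "('k, 'a) normed_module \<Rightarrow> ('k, 'b) normed_module \<Rightarrow> ('a \<Rightarrow> 'b) \<Rightarrow> real" where
  "opnorm E F T = (SUP x\<in>{x \<in> carrier E. nrm E x \<le> 1}. nrm F (T x))"

text \<open>
  \<open>Y\<close> ranges over the separable Banach spaces whose carrier is a set of elements of the type
  \<open>'y\<close>, since HOL cannot quantify over all types. With \<open>'y = nat \<Rightarrow> real\<close> this is no restriction:
  if \<open>d\<^sub>0, d\<^sub>1, \<dots>\<close> is dense in a separable Banach space, then
  \<open>x \<mapsto> (n \<mapsto> \<parallel>x - d\<^sub>n\<parallel>)\<close> is an injection of that space into \<open>nat \<Rightarrow> real\<close>,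
  along which the whole structure can be transported. Hence the property at \<open>'y = nat \<Rightarrow> real\<close> implies
  the property at every other type \<open>'y\<close>.
\<close>

definition has_SEP ::
  "'y itself \<Rightarrow> real \<Rightarrow> ('k::{real_normed_field, euclidean_space}, 'a) normed_module \<Rightarrow> bool" where
  "has_SEP _ lam Z \<longleftrightarrow>
     banach_space Z \<and>
     (\<forall>(Y :: ('k, 'y) normed_module) V T.
        banach_space Y \<and> separable_space (ntopology Y) \<and> closed_subspace V Y \<and>
        bounded_operator (Y\<lparr>carrier := V\<rparr>) Z T \<longrightarrow>
        (\<exists>T'. bounded_operator Y Z T' \<and> (\<forall>x\<in>V. T' x = T x) \<and>
              opnorm Y Z T' \<le> lam * opnorm (Y\<lparr>carrier := V\<rparr>) Z T))"

definition c0_sum :: "(nat \<Rightarrow> ('k, 'a) normed_module) \<Rightarrow> ('k, nat \<Rightarrow> 'a) normed_module" where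
  "c0_sum Z =
     \<lparr>carrier = {z. (\<forall>j. z j \<in> carrier (Z j)) \<and> (\<lambda>j. nrm (Z j) (z j)) \<longlonglongrightarrow> 0},
      monoid.mult = undefined, one = undefined,
      zero = (\<lambda>j. \<zero>\<^bsub>Z j\<^esub>),
      add = (\<lambda>z w j. z j \<oplus>\<^bsub>Z j\<^esub> w j),
      smult = (\<lambda>a z j. a \<odot>\<^bsub>Z j\<^esub> z j),
      nrm = (\<lambda>z. SUP j. nrm (Z j) (z j))\<rparr>"

end

theory Submission
  imports Defs
begin

text \<open>
  Let \<open>T = (T\<^sub>j)\<close> be an operator of norm \<open>M\<close> from a closed subspace \<open>V\<close> of a separable Banach space
  \<open>Y\<close> into the \<open>c\<^sub>0\<close>-sum. Each coordinate \<open>T\<^sub>j\<close> has norm at most \<open>M\<close> and extends to \<open>Y\<close> with the same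
  norm, but extensions chosen independently need not tend to \<open>0\<close> at the points of \<open>Y\<close> outside \<open>V\<close>.
  The idea is to prescribe the value \<open>0\<close> on more and more vectors outside \<open>V\<close> as \<open>j\<close> grows, and to
  use the \<open>1\<close>-SEP of \<open>Z\<^sub>j\<close> only for the resulting operator on a larger subspace.

  In detail, let \<open>W = V + F\<close> with \<open>F\<close> finite-dimensional and \<open>V \<inter> F = {0}\<close>, and let \<open>P : W \<rightarrow> V\<close> be the
  projection with kernel \<open>F\<close>. The operator \<open>T\<^sub>j \<circ> P\<close> agrees with \<open>T\<^sub>j\<close> on \<open>V\<close> and vanishes on \<open>F\<close>.
  Its norm is at most \<open>(2 + \<epsilon>) M\<close> for all large \<open>j\<close>: the map \<open>w \<mapsto> w - P w\<close> sends the unit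
  ball of \<open>W\<close> to a totally bounded set, so there are finitely many \<open>n\<close> in the unit ball such that every
  \<open>w\<close> of the unit ball has \<open>w - P w\<close> within \<open>\<delta>\<close> of some \<open>n - P n\<close>. Then
  \<open>\<parallel>P w - P n\<parallel> \<le> \<parallel>w - n\<parallel> + \<delta> \<le> 2 + \<delta>\<close>, while \<open>T\<^sub>j (P n)\<close> is small for the finitely many \<open>n\<close>
  once \<open>j\<close> is large. This is the lemma \<open>eventually_compose_projection_bound\<close>, and the constant \<open>2\<close> of the
  theorem is the diameter of the unit ball.

  Adjoining the terms of a dense sequence of \<open>Y\<close> one at a time gives subspaces \<open>W\<^sub>0 = V \<subseteq> W\<^sub>1 \<subseteq> \<dots>\<close>
  with dense union and projections \<open>P\<^sub>n\<close> that extend each other (\<open>projection_chain\<close>). For each \<open>j\<close> let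
  \<open>N = N j\<close> be the largest stage up to \<open>j\<close> at which \<open>T\<^sub>j \<circ> P\<^sub>N\<close> has norm at most \<open>(2 + \<epsilon>) M\<close>. Then
  \<open>N j\<close> tends to infinity. Extensions \<open>G\<^sub>j\<close> of \<open>T\<^sub>j \<circ> P\<^sub>N\<close> to \<open>Y\<close> with the same norm bound are uniformly bounded, and
  on a vector \<open>w\<close> of \<open>W\<^sub>n\<close> they are eventually equal to \<open>T\<^sub>j (P\<^sub>n w)\<close>, which tends to \<open>0\<close>. Hence they
  tend to \<open>0\<close> at every point (\<open>extend_null_sequence\<close>) and \<open>y \<mapsto> (G\<^sub>j y)\<close> is the required operator.

  Two supporting facts complete the proof: the \<open>c\<^sub>0\<close>-sum is a Banach space (\<open>banach_space_c0_sum\<close>),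
  and the extension property for spaces carried by \<open>nat \<Rightarrow> real\<close> implies it for spaces carried by any
  other type (\<open>has_SEP_any_type\<close>).
\<close>

section \<open>The normed structure and its topology in terms of the norm\<close>

text \<open>
  The additive inverse is given as \<open>(-1) \<odot> x\<close>, so that the existence of inverses can be checked by an
  equation between the operations of the record.
\<close>

lemma normed_vector_spaceI:
  fixes E :: "('k::{real_normed_field, euclidean_space}, 'a) normed_module" (structure)
  assumes zero: "\<zero> \<in> carrier E"
    and add: "\<And>x y. x \<in> carrier E \<Longrightarrow> y \<in> carrier E \<Longrightarrow> x \<oplus> y \<in> carrier E"
    and smult: "\<And>a x. x \<in> carrier E \<Longrightarrow> a \<odot> x \<in> carrier E"
    and assoc: "\<And>x y z. x \<in> carrier E \<Longrightarrow> y \<in> carrier E \<Longrightarrow> z \<in> carrier E \<Longrightarrow>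
                  (x \<oplus> y) \<oplus> z = x \<oplus> (y \<oplus> z)"
    and comm: "\<And>x y. x \<in> carrier E \<Longrightarrow> y \<in> carrier E \<Longrightarrow> x \<oplus> y = y \<oplus> x"
    and l_zero: "\<And>x. x \<in> carrier E \<Longrightarrow> \<zero> \<oplus> x = x"
    and l_neg: "\<And>x. x \<in> carrier E \<Longrightarrow> (-1) \<odot> x \<oplus> x = \<zero>"
    and l_distr: "\<And>a b x. x \<in> carrier E \<Longrightarrow> (a + b) \<odot> x = a \<odot> x \<oplus> b \<odot> x"
    and r_distr: "\<And>a x y. x \<in> carrier E \<Longrightarrow> y \<in> carrier E \<Longrightarrow> a \<odot> (x \<oplus> y) = a \<odot> x \<oplus> a \<odot> y"
    and smult_assoc: "\<And>a b x. x \<in> carrier E \<Longrightarrow> (a * b) \<odot> x = a \<odot> (b \<odot> x)"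
    and smult_one: "\<And>x. x \<in> carrier E \<Longrightarrow> 1 \<odot> x = x"
    and nrm_0: "\<And>x. x \<in> carrier E \<Longrightarrow> nrm E x = 0 \<longleftrightarrow> x = \<zero>"
    and nrm_add: "\<And>x y. x \<in> carrier E \<Longrightarrow> y \<in> carrier E \<Longrightarrow> nrm E (x \<oplus> y) \<le> nrm E x + nrm E y"
    and nrm_smult: "\<And>a x. x \<in> carrier E \<Longrightarrow> nrm E (a \<odot> x) = norm a * nrm E x"
  shows "normed_vector_space E"
proof (intro normed_vector_space.intro normed_vector_space_axioms.intro)
  have "abelian_group E"
  proof (rule abelian_groupI)
    show "\<exists>y\<in>carrier E. y \<oplus> x = \<zero>" if "x \<in> carrier E" for x
      using l_neg[OF that] smult[OF that] by blast
  qed (use assms in auto)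
  then show "Module.module (ring_of_type_algebra :: 'k ring) E"
    by (intro moduleI) (use assms in \<open>auto simp: ring_of_type_algebra_def cring_from_type_algebra[unfolded ring_of_type_algebra_def]\<close>)
qed (use nrm_0 nrm_add nrm_smult in auto)

context normed_vector_space
begin

lemma zero_in: "\<zero> \<in> carrier E"
  by (rule M.zero_closed)

lemma smult_in [simp, intro]: "x \<in> carrier E \<Longrightarrow> a \<odot> x \<in> carrier E"
  using smult_closed[of a x] by (simp add: ring_of_type_algebra_def)

lemma smult_add_left: "x \<in> carrier E \<Longrightarrow> (a + b) \<odot> x = a \<odot> x \<oplus> b \<odot> x"
  using smult_l_distr[of a b x] by (simp add: ring_of_type_algebra_def)

lemma smult_add_right: "x \<in> carrier E \<Longrightarrow> y \<in> carrier E \<Longrightarrow> a \<odot> (x \<oplus> y) = a \<odot> x \<oplus> a \<odot> y"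
  using smult_r_distr[of a x y] by (simp add: ring_of_type_algebra_def)

lemma smult_smult: "x \<in> carrier E \<Longrightarrow> a \<odot> (b \<odot> x) = (a * b) \<odot> x"
  using smult_assoc1[of a b x] by (simp add: ring_of_type_algebra_def)

lemma one_smult [simp]: "x \<in> carrier E \<Longrightarrow> 1 \<odot> x = x"
  using smult_one[of x] by (simp add: ring_of_type_algebra_def)

lemma zero_smult [simp]: "x \<in> carrier E \<Longrightarrow> 0 \<odot> x = \<zero>"
  using smult_l_null[of x] by (simp add: ring_of_type_algebra_def)

lemma smult_zero [simp]: "a \<odot> \<zero> = \<zero>"
  using smult_r_null[of a] by (simp add: ring_of_type_algebra_def)

lemma a_inv_eq_smult:
  assumes "x \<in> carrier E" shows "\<ominus> x = (-1) \<odot> x"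
proof (rule M.minus_equality)
  show "(-1) \<odot> x \<oplus> x = \<zero>"
    using smult_add_left[of x "-1" 1] assms by simp
qed (use assms in auto)

text \<open>
  Writing subtraction with the two primitive operations makes it independent of the carrier, which is
  what permits passing between a space and its subspaces, copies and \<open>c\<^sub>0\<close>-sums.
\<close>

lemma a_minus_eq_smult: "x \<in> carrier E \<Longrightarrow> y \<in> carrier E \<Longrightarrow> x \<ominus> y = x \<oplus> (-1) \<odot> y"
  by (simp add: M.minus_eq a_inv_eq_smult)

lemma smult_diff_left: "x \<in> carrier E \<Longrightarrow> (a - b) \<odot> x = a \<odot> x \<ominus> b \<odot> x"
  using smult_add_left[of x a "-b"] by (simp add: a_minus_eq_smult smult_smult)

lemma add_diff_add:
  assumes "x \<in> carrier E" "y \<in> carrier E" "z \<in> carrier E" "w \<in> carrier E"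
  shows "(x \<oplus> y) \<ominus> (z \<oplus> w) = (x \<ominus> z) \<oplus> (y \<ominus> w)"
  using assms by (simp add: M.minus_eq M.minus_add M.a_ac)

lemma diff_add_diff [simp]:
  assumes "x \<in> carrier E" "y \<in> carrier E" "z \<in> carrier E"
  shows "(x \<ominus> y) \<oplus> (y \<ominus> z) = x \<ominus> z"
  using assms by (simp add: M.minus_eq M.a_ac M.r_neg2 M.r_neg1)

lemma diff_add_cancel' [simp]:
  assumes "x \<in> carrier E" "y \<in> carrier E"
  shows "(x \<ominus> y) \<oplus> y = x" "y \<oplus> (x \<ominus> y) = x" "(x \<oplus> y) \<ominus> y = x" "(y \<oplus> x) \<ominus> y = x"
  using assms by (simp_all add: M.minus_eq M.a_ac M.r_neg M.r_neg2 M.r_neg1)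

lemma diff_self [simp]: "x \<in> carrier E \<Longrightarrow> x \<ominus> x = \<zero>"
  by (simp add: M.minus_eq M.r_neg)

lemma diff_zero [simp]: "x \<in> carrier E \<Longrightarrow> x \<ominus> \<zero> = x"
  by (simp add: M.minus_eq)

lemma nrm_zero [simp]: "nrm E \<zero> = 0"
  by (simp add: nrm_eq_0_iff)

lemma nrm_minus_commute:
  assumes "x \<in> carrier E" "y \<in> carrier E" shows "nrm E (x \<ominus> y) = nrm E (y \<ominus> x)"
proof -
  have "(-1) \<odot> (y \<ominus> x) = x \<ominus> y"
    using assms by (simp add: a_minus_eq_smult smult_add_right smult_smult M.a_comm)
  then show ?thesis
    using nrm_smult[of "y \<ominus> x" "-1"] assms by simp
qed

lemma nrm_triangle_diff:
  assumes "x \<in> carrier E" "y \<in> carrier E" "z \<in> carrier E"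
  shows "nrm E (x \<ominus> z) \<le> nrm E (x \<ominus> y) + nrm E (y \<ominus> z)"
  using nrm_triangle[of "x \<ominus> y" "y \<ominus> z"] assms by simp

lemma nrm_diff_le:
  assumes "x \<in> carrier E" "y \<in> carrier E"
  shows "nrm E (x \<ominus> y) \<le> nrm E x + nrm E y"
  using nrm_triangle_diff[of x \<zero> y] nrm_minus_commute[of \<zero> y] assms by simp

lemma nrm_nonneg [simp]: "x \<in> carrier E \<Longrightarrow> 0 \<le> nrm E x"
  using nrm_diff_le[of x x] by simp

lemma nrm_le_diff:
  assumes "x \<in> carrier E" "y \<in> carrier E"
  shows "nrm E x \<le> nrm E (x \<ominus> y) + nrm E y"
  using nrm_triangle_diff[of x y \<zero>] assms by simp

lemma diff_eq_zero_iff: "x \<in> carrier E \<Longrightarrow> y \<in> carrier E \<Longrightarrow> x \<ominus> y = \<zero> \<longleftrightarrow> x = y"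
  by (metis diff_add_cancel'(1) diff_self M.l_zero)

lemma Metric_space: "Metric_space (carrier E) (ndist E)"
proof
  show "ndist E x y = 0 \<longleftrightarrow> x = y" if "x \<in> carrier E" "y \<in> carrier E" for x y
    using that by (simp add: ndist_def nrm_eq_0_iff diff_eq_zero_iff)
qed (auto simp: ndist_def nrm_minus_commute nrm_triangle_diff)

text \<open>
  The topological notions are restated by inequalities between norms because those are
  transported immediately along a linear isometry and pass to coordinates.
\<close>

lemma closedin_iff_nrm:
  "closedin (ntopology E) V \<longleftrightarrow> V \<subseteq> carrier E \<and>
     (\<forall>x\<in>carrier E - V. \<exists>r>0. \<forall>y\<in>V. r \<le> nrm E (x \<ominus> y))"
proof -
  interpret MS: Metric_space "carrier E" "ndist E" by (rule Metric_space)
  have "(\<exists>r>0. disjnt V (MS.mball x r)) \<longleftrightarrow> (\<exists>r>0. \<forall>y\<in>V. r \<le> nrm E (x \<ominus> y))"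
    if "V \<subseteq> carrier E" "x \<in> carrier E" for x
    using that by (intro ex_cong conj_cong) (auto simp: disjnt_iff ndist_def not_less subset_iff)
  then show ?thesis
    unfolding MS.closedin_metric by (auto simp del: MS.in_mball)
qed

lemma separable_iff_nrm:
  "separable_space (ntopology E) \<longleftrightarrow>
     (\<exists>d::nat \<Rightarrow> 'a. range d \<subseteq> carrier E \<and> (\<forall>x\<in>carrier E. \<forall>e>0. \<exists>n. nrm E (x \<ominus> d n) < e))"
proof
  interpret MS: Metric_space "carrier E" "ndist E" by (rule Metric_space)
  assume "separable_space (ntopology E)"
  then obtain U where U: "countable U" "U \<subseteq> carrier E" "Abstract_Topology.closure_of (ntopology E) U = carrier E"
    unfolding separable_space_def by auto
  then have dense: "\<exists>u\<in>U. nrm E (x \<ominus> u) < e" if "x \<in> carrier E" and e: "e > 0" for x e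
  proof -
    have "x \<in> Abstract_Topology.closure_of (ntopology E) U"
      using that U(3) by simp
    then obtain u where "u \<in> U" "u \<in> MS.mball x e"
      using e unfolding MS.metric_closure_of by blast
    then show ?thesis by (auto simp: ndist_def)
  qed
  then have "U \<noteq> {}"
    using dense[OF M.zero_closed zero_less_one] by blast
  then show "\<exists>d::nat \<Rightarrow> 'a. range d \<subseteq> carrier E \<and> (\<forall>x\<in>carrier E. \<forall>e>0. \<exists>n. nrm E (x \<ominus> d n) < e)"
    using U(1,2) dense by (intro exI[of _ "from_nat_into U"]) (auto simp: from_nat_into, metis from_nat_into_surj)
next
  interpret MS: Metric_space "carrier E" "ndist E" by (rule Metric_space)
  assume "\<exists>d::nat \<Rightarrow> 'a. range d \<subseteq> carrier E \<and> (\<forall>x\<in>carrier E. \<forall>e>0. \<exists>n. nrm E (x \<ominus> d n) < e)"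
  then obtain d :: "nat \<Rightarrow> 'a" where "range d \<subseteq> carrier E"
    and "\<forall>x\<in>carrier E. \<forall>e>0. \<exists>n. nrm E (x \<ominus> d n) < e" by blast
  then show "separable_space (ntopology E)"
    unfolding separable_space_def MS.metric_closure_of
    by (intro exI[of _ "range d"]) (auto simp: ndist_def image_subset_iff)
qed

lemma mcomplete_iff_nrm:
  "Metric_space.mcomplete (carrier E) (ndist E) \<longleftrightarrow>
     (\<forall>s::nat \<Rightarrow> 'a. range s \<subseteq> carrier E \<longrightarrow>
        (\<forall>e>0. \<exists>N. \<forall>m\<ge>N. \<forall>n\<ge>N. nrm E (s m \<ominus> s n) < e) \<longrightarrow>
        (\<exists>l\<in>carrier E. (\<lambda>n. nrm E (s n \<ominus> l)) \<longlonglongrightarrow> 0))"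
proof -
  interpret MS: Metric_space "carrier E" "ndist E" by (rule Metric_space)
  have cauchy: "MS.MCauchy s \<longleftrightarrow> range s \<subseteq> carrier E \<and> (\<forall>e>0. \<exists>N. \<forall>m\<ge>N. \<forall>n\<ge>N. nrm E (s m \<ominus> s n) < e)" for s
    unfolding MS.MCauchy_def by (auto simp: ndist_def image_subset_iff)
  have lim: "limitin (ntopology E) s l sequentially \<longleftrightarrow> l \<in> carrier E \<and> (\<lambda>n. nrm E (s n \<ominus> l)) \<longlonglongrightarrow> 0"
    if "range s \<subseteq> carrier E" for s l
    using that unfolding MS.limitin_metric_dist_null by (auto simp: ndist_def image_subset_iff)
  show ?thesis
    unfolding MS.mcomplete_def cauchy using lim by (auto simp: Bex_def)
qed

end

section \<open>Linear maps and operator norms\<close>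

definition linear_between ::
  "('k, 'a) normed_module \<Rightarrow> ('k, 'b) normed_module \<Rightarrow> ('a \<Rightarrow> 'b) \<Rightarrow> bool" where
  "linear_between E F T \<longleftrightarrow>
     T \<in> carrier E \<rightarrow> carrier F \<and>
     (\<forall>x\<in>carrier E. \<forall>y\<in>carrier E. T (x \<oplus>\<^bsub>E\<^esub> y) = T x \<oplus>\<^bsub>F\<^esub> T y) \<and>
     (\<forall>a. \<forall>x\<in>carrier E. T (a \<odot>\<^bsub>E\<^esub> x) = a \<odot>\<^bsub>F\<^esub> T x)"

lemma bounded_operator_iff_linear:
  "bounded_operator E F T \<longleftrightarrow>
     linear_between E F T \<and> (\<exists>K. \<forall>x\<in>carrier E. nrm F (T x) \<le> K * nrm E x)"
  by (auto simp: bounded_operator_def linear_between_def)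

lemma
  assumes "linear_between E F T"
  shows linear_between_closed: "x \<in> carrier E \<Longrightarrow> T x \<in> carrier F"
    and linear_between_add: "x \<in> carrier E \<Longrightarrow> y \<in> carrier E \<Longrightarrow> T (x \<oplus>\<^bsub>E\<^esub> y) = T x \<oplus>\<^bsub>F\<^esub> T y"
    and linear_between_smult: "x \<in> carrier E \<Longrightarrow> T (a \<odot>\<^bsub>E\<^esub> x) = a \<odot>\<^bsub>F\<^esub> T x"
  using assms by (auto simp: linear_between_def)

lemma linear_between_zero:
  assumes "normed_vector_space E" "normed_vector_space F" "linear_between E F T"
  shows "T \<zero>\<^bsub>E\<^esub> = \<zero>\<^bsub>F\<^esub>"
proof -
  interpret E: normed_vector_space E by fact
  interpret F: normed_vector_space F by fact
  show ?thesis
    using linear_between_smult[OF assms(3), of "\<zero>\<^bsub>E\<^esub>" 0] linear_between_closed[OF assms(3), of "\<zero>\<^bsub>E\<^esub>"]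
    by simp
qed

lemma linear_between_diff:
  assumes "normed_vector_space E" "normed_vector_space F" "linear_between E F T"
    and "x \<in> carrier E" "y \<in> carrier E"
  shows "T (x \<ominus>\<^bsub>E\<^esub> y) = T x \<ominus>\<^bsub>F\<^esub> T y"
proof -
  interpret E: normed_vector_space E by fact
  interpret F: normed_vector_space F by fact
  show ?thesis
    using assms(4,5) linear_between_closed[OF assms(3)]
    by (simp add: E.a_minus_eq_smult F.a_minus_eq_smult linear_between_add[OF assms(3)]
        linear_between_smult[OF assms(3)])
qed

lemma bdd_above_opnorm:
  assumes "normed_vector_space E" "bounded_operator E F T"
  shows "bdd_above ((\<lambda>x. nrm F (T x)) ` {x \<in> carrier E. nrm E x \<le> 1})"
proof -
  obtain K where K: "\<And>x. x \<in> carrier E \<Longrightarrow> nrm F (T x) \<le> K * nrm E x"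
    using assms(2) unfolding bounded_operator_def by blast
  show ?thesis
  proof (rule bdd_aboveI2)
    fix x assume "x \<in> {x \<in> carrier E. nrm E x \<le> 1}"
    then have "nrm F (T x) \<le> K * nrm E x" "K * nrm E x \<le> \<bar>K\<bar> * nrm E x" "\<bar>K\<bar> * nrm E x \<le> \<bar>K\<bar> * 1"
      using K by (auto intro!: mult_right_mono mult_left_mono normed_vector_space.nrm_nonneg[OF assms(1)]
          simp del: mult_1_right)
    then show "nrm F (T x) \<le> \<bar>K\<bar>" by simp
  qed
qed

text \<open>
  A vector of norm \<open>0\<close> is dealt with by the bound contained in the definition of a bounded operator; every
  other vector is scaled to norm \<open>1\<close>.
\<close>

lemma nrm_le_opnorm:
  assumes "normed_vector_space E" "normed_vector_space F" "bounded_operator E F T"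
    and x: "x \<in> carrier E"
  shows "nrm F (T x) \<le> opnorm E F T * nrm E x"
proof -
  have lin: "linear_between E F T" using assms(3) by (simp add: bounded_operator_iff_linear)
  obtain K where K: "\<And>x. x \<in> carrier E \<Longrightarrow> nrm F (T x) \<le> K * nrm E x"
    using assms(3) unfolding bounded_operator_def by blast
  note bdd = bdd_above_opnorm[OF assms(1,3)]
  show ?thesis
  proof (cases "nrm E x = 0")
    case True
    then show ?thesis using x K[OF x] by simp
  next
    case False
    define r where "r = nrm E x"
    have r: "r > 0" using False normed_vector_space.nrm_nonneg[OF assms(1) x] by (simp add: r_def)
    define u where "u = of_real (1/r) \<odot>\<^bsub>E\<^esub> x"
    have u: "u \<in> carrier E" "nrm E u = 1" using x r
      by (auto simp: u_def r_def norm_divide normed_vector_space.smult_in[OF assms(1)]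
          normed_vector_space.nrm_smult[OF assms(1)])
    have "nrm F (T u) \<le> opnorm E F T"
      unfolding opnorm_def by (rule cSUP_upper[OF _ bdd]) (use u in auto)
    moreover have "nrm F (T u) = nrm F (T x) / r"
      using x r linear_between_closed[OF lin x] 
      by (simp add: u_def linear_between_smult[OF lin] normed_vector_space.nrm_smult[OF assms(2)] norm_divide)
    ultimately show ?thesis using r by (simp add: r_def[symmetric] field_simps)
  qed
qed

lemma opnorm_le:
  assumes "normed_vector_space E" and K: "K \<ge> 0"
    and "\<And>x. x \<in> carrier E \<Longrightarrow> nrm F (T x) \<le> K * nrm E x"
  shows "opnorm E F T \<le> K"
  unfolding opnorm_def
proof (rule cSUP_least)
  show "{x \<in> carrier E. nrm E x \<le> 1} \<noteq> {}" 
    using normed_vector_space.zero_in[OF assms(1)] normed_vector_space.nrm_zero[OF assms(1)]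
    by (auto intro!: exI[of _ "\<zero>\<^bsub>E\<^esub>"])
  fix x assume "x \<in> {x \<in> carrier E. nrm E x \<le> 1}"
  then show "nrm F (T x) \<le> K"
    using assms(3)[of x] mult_left_mono[of "nrm E x" 1 K] K by auto
qed

lemma opnorm_nonneg:
  assumes "normed_vector_space E" "normed_vector_space F" "bounded_operator E F T"
  shows "0 \<le> opnorm E F T"
proof -
  have lin: "linear_between E F T" using assms(3) by (simp add: bounded_operator_iff_linear)
  note bdd = bdd_above_opnorm[OF assms(1,3)]
  have "nrm F (T \<zero>\<^bsub>E\<^esub>) \<le> opnorm E F T"
    unfolding opnorm_def
    by (rule cSUP_upper[OF _ bdd])
       (simp add: normed_vector_space.zero_in[OF assms(1)] normed_vector_space.nrm_zero[OF assms(1)])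
  then show ?thesis
    by (simp add: linear_between_zero[OF assms(1,2) lin] normed_vector_space.nrm_zero[OF assms(2)])
qed

section \<open>Closed subspaces and the adjunction of a vector\<close>

context normed_vector_space
begin

lemma submodule_iff:
  "submodule W (ring_of_type_algebra :: 'k ring) E \<longleftrightarrow>
     W \<subseteq> carrier E \<and> \<zero> \<in> W \<and> (\<forall>x\<in>W. \<forall>y\<in>W. x \<oplus> y \<in> W) \<and> (\<forall>a. \<forall>x\<in>W. a \<odot> x \<in> W)"
proof
  assume W: "submodule W (ring_of_type_algebra :: 'k ring) E"
  note E = submoduleE[OF W]
  have "\<zero> \<in> W" using W by (auto simp: submodule_def dest: subgroup.one_closed)
  then show "W \<subseteq> carrier E \<and> \<zero> \<in> W \<and> (\<forall>x\<in>W. \<forall>y\<in>W. x \<oplus> y \<in> W) \<and> (\<forall>a. \<forall>x\<in>W. a \<odot> x \<in> W)"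
    using E by (auto simp: ring_of_type_algebra_def)
next
  assume *: "W \<subseteq> carrier E \<and> \<zero> \<in> W \<and> (\<forall>x\<in>W. \<forall>y\<in>W. x \<oplus> y \<in> W) \<and> (\<forall>a. \<forall>x\<in>W. a \<odot> x \<in> W)"
  show "submodule W (ring_of_type_algebra :: 'k ring) E"
    by (rule submoduleI) (use * in \<open>auto simp: a_inv_eq_smult subset_iff\<close>)
qed

lemma
  assumes "closed_subspace W E"
  shows closed_subspace_subset: "W \<subseteq> carrier E"
    and closed_subspace_in: "x \<in> W \<Longrightarrow> x \<in> carrier E"
    and closed_subspace_zero: "\<zero> \<in> W"
    and closed_subspace_add: "x \<in> W \<Longrightarrow> y \<in> W \<Longrightarrow> x \<oplus> y \<in> W"
    and closed_subspace_smult: "x \<in> W \<Longrightarrow> a \<odot> x \<in> W"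
    and closed_subspace_gap: "x \<in> carrier E \<Longrightarrow> x \<notin> W \<Longrightarrow> \<exists>r>0. \<forall>y\<in>W. r \<le> nrm E (x \<ominus> y)"
  using assms by (auto simp: closed_subspace_def submodule_iff closedin_iff_nrm)

lemma closed_subspace_diff:
  "closed_subspace W E \<Longrightarrow> x \<in> W \<Longrightarrow> y \<in> W \<Longrightarrow> x \<ominus> y \<in> W"
  by (simp add: a_minus_eq_smult closed_subspace_in closed_subspace_add closed_subspace_smult)

lemma normed_vector_space_restrict:
  assumes "closed_subspace W E"
  shows "normed_vector_space (E\<lparr>carrier := W\<rparr>)"
proof (intro normed_vector_space.intro normed_vector_space_axioms.intro)
  show "Module.module (ring_of_type_algebra :: 'k ring) (E\<lparr>carrier := W\<rparr>)"
    using assms submodule.submodule_is_module module_axioms unfolding closed_subspace_def by blast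
qed (use closed_subspace_in[OF assms] in \<open>auto simp: nrm_eq_0_iff nrm_triangle nrm_smult\<close>)

lemma a_minus_restrict:
  assumes "closed_subspace W E" "x \<in> W" "y \<in> W"
  shows "x \<ominus>\<^bsub>E\<lparr>carrier := W\<rparr>\<^esub> y = x \<ominus> y"
  using normed_vector_space.a_minus_eq_smult[OF normed_vector_space_restrict[OF assms(1)], of x y]
    assms closed_subspace_in[OF assms(1)] by (simp add: a_minus_eq_smult)

text \<open>
  Dividing \<open>w + a v\<close> by \<open>a\<close> gives a difference of \<open>v\<close> and an element of \<open>W\<close>, and its norm is at
  least the distance \<open>d\<close> from \<open>v\<close> to \<open>W\<close>. In other words, the coefficient of \<open>v\<close> is a bounded functional
  on \<open>W + k v\<close>.
\<close>

lemma gap_bound: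
  assumes W: "closed_subspace W E" and v: "v \<in> carrier E" "v \<notin> W"
  shows "\<exists>d>0. \<forall>w\<in>W. \<forall>a. norm a * d \<le> nrm E (w \<oplus> a \<odot> v)"
proof -
  obtain d where d: "d > 0" "\<And>y. y \<in> W \<Longrightarrow> d \<le> nrm E (v \<ominus> y)"
    using closed_subspace_gap[OF W v] by blast
  have "norm a * d \<le> nrm E (w \<oplus> a \<odot> v)" if w: "w \<in> W" for w a
  proof (cases "a = 0")
    case True
    then show ?thesis using w v closed_subspace_in[OF W w] by simp
  next
    case False
    define y where "y = (- (1 / a)) \<odot> w"
    have y: "y \<in> W" using closed_subspace_smult[OF W w] by (simp add: y_def)
    have "w \<oplus> a \<odot> v = a \<odot> (v \<ominus> y)"
      using False w v closed_subspace_in[OF W]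
      by (simp add: y_def a_minus_eq_smult smult_add_right smult_smult M.a_comm)
    then have "nrm E (w \<oplus> a \<odot> v) = norm a * nrm E (v \<ominus> y)"
      using y v closed_subspace_in[OF W] by (simp add: nrm_smult)
    then show ?thesis using d(2)[OF y] by (simp add: mult_left_mono)
  qed
  then show ?thesis using d(1) by blast
qed

definition adjoin :: "'a set \<Rightarrow> 'a \<Rightarrow> 'a set" where
  "adjoin W v = {w \<oplus> a \<odot> v |w a. w \<in> W}"

lemma add_smult_diff:
  assumes "x \<in> carrier E" "y \<in> carrier E" "v \<in> carrier E"
  shows "(x \<oplus> a \<odot> v) \<ominus> (y \<oplus> b \<odot> v) = (x \<ominus> y) \<oplus> (a - b) \<odot> v"
  using assms by (simp add: add_diff_add smult_diff_left)

text \<open>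
  If \<open>w\<^sub>n + a\<^sub>n v\<close> converges to \<open>x\<close>, then \<open>gap_bound\<close> makes the coefficients \<open>a\<^sub>n\<close> a Cauchy sequence of
  scalars. With \<open>l\<close> its limit, \<open>w\<^sub>n\<close> converges to \<open>x - l v\<close>, which lies in \<open>W\<close> because \<open>W\<close> is closed.
\<close>

lemma closed_subspace_adjoin:
  assumes W: "closed_subspace W E" and v: "v \<in> carrier E" "v \<notin> W"
  shows "closed_subspace (adjoin W v) E"
proof -
  note Win = closed_subspace_in[OF W]
  obtain d where d: "d > 0" "\<And>w a. w \<in> W \<Longrightarrow> norm a * d \<le> nrm E (w \<oplus> a \<odot> v)"
    using gap_bound[OF W v] by blast
  have sub: "adjoin W v \<subseteq> carrier E" using v Win by (auto simp: adjoin_def)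
  have "submodule (adjoin W v) (ring_of_type_algebra :: 'k ring) E"
    unfolding submodule_iff
  proof (intro conjI ballI allI)
    show "\<zero> \<in> adjoin W v"
      unfolding adjoin_def using closed_subspace_zero[OF W] v
      by (intro CollectI exI[of _ \<zero>] exI[of _ 0]) simp
    fix x y assume "x \<in> adjoin W v" "y \<in> adjoin W v"
    then obtain w a w' a' where e: "x = w \<oplus> a \<odot> v" "y = w' \<oplus> a' \<odot> v" "w \<in> W" "w' \<in> W"
      by (auto simp: adjoin_def)
    then have "x \<oplus> y = (w \<oplus> w') \<oplus> (a + a') \<odot> v"
      using v Win by (simp add: smult_add_left M.a_ac)
    then show "x \<oplus> y \<in> adjoin W v"
      using closed_subspace_add[OF W] e unfolding adjoin_def by blast
  next
    fix x a assume "x \<in> adjoin W v"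
    then obtain w b where e: "x = w \<oplus> b \<odot> v" "w \<in> W" by (auto simp: adjoin_def)
    then have "a \<odot> x = (a \<odot> w) \<oplus> (a * b) \<odot> v"
      using v Win by (simp add: smult_add_right smult_smult)
    then show "a \<odot> x \<in> adjoin W v"
      using closed_subspace_smult[OF W] e unfolding adjoin_def by blast
  qed (use sub in auto)
  moreover have "\<exists>r>0. \<forall>y\<in>adjoin W v. r \<le> nrm E (x \<ominus> y)" if x: "x \<in> carrier E" "x \<notin> adjoin W v" for x
  proof (rule ccontr)
    assume "\<not> ?thesis"
    then have "\<exists>y\<in>adjoin W v. nrm E (x \<ominus> y) < 1 / real (Suc n)" for n
      by (auto simp: not_le dest!: spec[of _ "1 / real (Suc n)"])
    then have "\<exists>w a. w \<in> W \<and> nrm E (x \<ominus> (w \<oplus> a \<odot> v)) < 1 / real (Suc n)" for n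
      unfolding adjoin_def by blast
    then obtain w a where wa: "\<And>n. w n \<in> W" "\<And>n. nrm E (x \<ominus> (w n \<oplus> a n \<odot> v)) < 1 / real (Suc n)"
      by metis
    have a_diff: "norm (a m - a n) * d \<le> 1 / real (Suc m) + 1 / real (Suc n)" for m n
    proof -
      have "norm (a m - a n) * d \<le> nrm E ((w m \<ominus> w n) \<oplus> (a m - a n) \<odot> v)"
        using d(2) closed_subspace_diff[OF W] wa(1) by blast
      also have "\<dots> = nrm E ((w m \<oplus> a m \<odot> v) \<ominus> (w n \<oplus> a n \<odot> v))"
        using add_smult_diff Win wa(1) v by simp
      also have "\<dots> \<le> nrm E ((w m \<oplus> a m \<odot> v) \<ominus> x) + nrm E (x \<ominus> (w n \<oplus> a n \<odot> v))"
        using nrm_triangle_diff Win wa(1) v x by simp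
      also have "nrm E ((w m \<oplus> a m \<odot> v) \<ominus> x) = nrm E (x \<ominus> (w m \<oplus> a m \<odot> v))"
        using nrm_minus_commute Win wa(1) v x by simp
      also have "\<dots> + nrm E (x \<ominus> (w n \<oplus> a n \<odot> v)) \<le> 1 / real (Suc m) + 1 / real (Suc n)"
        using wa(2)[of m] wa(2)[of n] by simp
      finally show ?thesis .
    qed
    have "Cauchy a"
    proof (rule CauchyI)
      fix e :: real assume "e > 0"
      then obtain N where N: "1 / real (Suc N) < e * d / 2"
        using d(1) nat_approx_posE[of "e * d / 2"] by auto
      have "norm (a m - a n) < e" if "m \<ge> N" "n \<ge> N" for m n
      proof -
        have "1 / real (Suc m) \<le> 1 / real (Suc N)" "1 / real (Suc n) \<le> 1 / real (Suc N)"
          using that by (auto intro!: divide_left_mono)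
        then have "norm (a m - a n) * d < e * d" using a_diff[of m n] N by linarith
        then show ?thesis using d(1) by simp
      qed
      then show "\<exists>N. \<forall>m\<ge>N. \<forall>n\<ge>N. norm (a m - a n) < e" by blast
    qed
    then obtain l where l: "a \<longlonglongrightarrow> l" using Cauchy_convergent_iff convergent_def by blast
    have "x \<ominus> l \<odot> v \<notin> W"
    proof
      assume "x \<ominus> l \<odot> v \<in> W"
      then have "(x \<ominus> l \<odot> v) \<oplus> l \<odot> v \<in> adjoin W v" unfolding adjoin_def by blast
      then show False using x v by simp
    qed
    then obtain r where r: "r > 0" "\<And>y. y \<in> W \<Longrightarrow> r \<le> nrm E ((x \<ominus> l \<odot> v) \<ominus> y)"
      using closed_subspace_gap[OF W, of "x \<ominus> l \<odot> v"] x v by auto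
    have "r \<le> 1 / real (Suc n) + norm (a n - l) * nrm E v" for n
    proof -
      have "(x \<ominus> l \<odot> v) \<ominus> w n = (x \<ominus> (w n \<oplus> a n \<odot> v)) \<oplus> (a n - l) \<odot> v"
        using x v Win[OF wa(1)] M.a_lcomm[of "a n \<odot> v" "\<ominus> (l \<odot> v)" "\<ominus> (a n \<odot> v)"]
        by (simp add: M.r_neg M.minus_eq smult_diff_left M.minus_add M.a_ac M.r_neg1 M.r_neg2)
      then have "nrm E ((x \<ominus> l \<odot> v) \<ominus> w n) \<le> nrm E (x \<ominus> (w n \<oplus> a n \<odot> v)) + norm (a n - l) * nrm E v"
        using nrm_triangle[of "x \<ominus> (w n \<oplus> a n \<odot> v)" "(a n - l) \<odot> v"] x v Win[OF wa(1)]
        by (simp add: nrm_smult)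
      then show ?thesis using r(2)[OF wa(1)[of n]] wa(2)[of n] by linarith
    qed
    moreover have "(\<lambda>n. 1 / real (Suc n) + norm (a n - l) * nrm E v) \<longlonglongrightarrow> 0 + 0 * nrm E v"
      using l by (intro tendsto_intros LIMSEQ_Suc lim_1_over_n tendsto_norm_zero)
         (auto simp: LIM_zero_iff)
    ultimately have "r \<le> 0 + 0 * nrm E v" by (intro LIMSEQ_le_const) auto
    then show False using r(1) by simp
  qed
  ultimately show ?thesis
    using sub by (auto simp: closed_subspace_def closedin_iff_nrm)
qed

end

context normed_vector_space
begin

section \<open>Projections that are the identity modulo a compact map\<close>

text \<open>
  The last condition says that \<open>w \<mapsto> w - P w\<close> sends bounded sets to totally bounded ones. It is
  the one consequence of \<open>dim (W / V) < \<infinity>\<close> on which the norm estimate rests, and it can be carried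
  along when a vector is adjoined, without choosing bases. The centres \<open>k\<close> of the nets range over the
  whole space, so that the nets for \<open>W + k v\<close> are sums of nets.
\<close>

definition projection_mod_compact :: "'a set \<Rightarrow> 'a set \<Rightarrow> ('a \<Rightarrow> 'a) \<Rightarrow> bool" where
  "projection_mod_compact V W P \<longleftrightarrow>
     closed_subspace V E \<and> closed_subspace W E \<and> V \<subseteq> W \<and>
     linear_between (E\<lparr>carrier := W\<rparr>) (E\<lparr>carrier := V\<rparr>) P \<and> (\<forall>x\<in>V. P x = x) \<and>
     (\<forall>R. \<forall>\<delta>>0. \<exists>K. finite K \<and> K \<subseteq> carrier E \<and>
        (\<forall>w\<in>W. nrm E w \<le> R \<longrightarrow> (\<exists>k\<in>K. nrm E ((w \<ominus> P w) \<ominus> k) \<le> \<delta>)))"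

lemma
  assumes "projection_mod_compact V W P"
  shows projection_mod_compact_dom: "closed_subspace W E"
    and projection_mod_compact_in: "w \<in> W \<Longrightarrow> P w \<in> V"
    and projection_mod_compact_add: "w \<in> W \<Longrightarrow> u \<in> W \<Longrightarrow> P (w \<oplus> u) = P w \<oplus> P u"
    and projection_mod_compact_smult: "w \<in> W \<Longrightarrow> P (a \<odot> w) = a \<odot> P w"
    and projection_mod_compact_nets: "\<delta> > 0 \<Longrightarrow> \<exists>K. finite K \<and> K \<subseteq> carrier E \<and>
        (\<forall>w\<in>W. nrm E w \<le> R \<longrightarrow> (\<exists>k\<in>K. nrm E ((w \<ominus> P w) \<ominus> k) \<le> \<delta>))"
  using assms by (auto simp: projection_mod_compact_def linear_between_def)

lemma projection_mod_compact_id: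
  assumes V: "closed_subspace V E"
  shows "projection_mod_compact V V (\<lambda>x. x)"
  using assms closed_subspace_in[OF V] unfolding projection_mod_compact_def linear_between_def
  by (auto intro!: exI[of _ "{\<zero>}"])

text \<open>
  Put \<open>P' (w + a v) = P w\<close>. By \<open>gap_bound\<close>, a bounded vector \<open>w + a v\<close> has a bounded coefficient \<open>a\<close>
  and hence a bounded part \<open>w\<close>. As \<open>y - P' y = (w - P w) + a v\<close> for \<open>y = w + a v\<close>, a net for \<open>P\<close> and a
  net in a ball of scalars combine to a net for \<open>P'\<close>.
\<close>

lemma projection_mod_compact_extend:
  assumes P: "projection_mod_compact V W P" and v: "v \<in> carrier E"
  shows "\<exists>W' P'. projection_mod_compact V W' P' \<and> W \<subseteq> W' \<and> v \<in> W' \<and> (\<forall>w\<in>W. P' w = P w)"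
proof (cases "v \<in> W")
  case True
  then show ?thesis using P by blast
next
  case False
  note W = projection_mod_compact_dom[OF P] and PV = projection_mod_compact_in[OF P]
  note Win = closed_subspace_in[OF W]
  have V: "closed_subspace V E" and VW: "V \<subseteq> W" and Pid: "\<And>x. x \<in> V \<Longrightarrow> P x = x"
    using P by (auto simp: projection_mod_compact_def)
  note Vin = closed_subspace_in[OF V]
  obtain d where d: "d > 0" "\<And>w a. w \<in> W \<Longrightarrow> norm a * d \<le> nrm E (w \<oplus> a \<odot> v)"
    using gap_bound[OF W v False] by blast
  define W' where "W' = adjoin W v"
  have W': "closed_subspace W' E" unfolding W'_def by (rule closed_subspace_adjoin[OF W v False])
  have inj: "w = u \<and> a = b" if "w \<in> W" "u \<in> W" "w \<oplus> a \<odot> v = u \<oplus> b \<odot> v" for w u a b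
  proof -
    have "norm (a - b) * d \<le> nrm E ((w \<ominus> u) \<oplus> (a - b) \<odot> v)"
      using d(2) closed_subspace_diff[OF W] that by blast
    also have "\<dots> = nrm E ((w \<oplus> a \<odot> v) \<ominus> (u \<oplus> b \<odot> v))"
      using add_smult_diff Win that(1,2) v by simp
    also have "\<dots> = nrm E ((u \<oplus> b \<odot> v) \<ominus> (u \<oplus> b \<odot> v))" by (simp only: that(3))
    also have "\<dots> = 0" using that(2) Win v by simp
    finally have "norm (a - b) * d \<le> 0" .
    then have "a = b" using d(1) by (simp add: mult_le_0_iff)
    then show ?thesis using that(3) Win[OF that(1)] Win[OF that(2)] v by simp
  qed
  define P' where "P' y = P (THE w. w \<in> W \<and> (\<exists>a. y = w \<oplus> a \<odot> v))" for y
  have P': "P' (w \<oplus> a \<odot> v) = P w" if "w \<in> W" for w a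
  proof -
    have "(THE u. u \<in> W \<and> (\<exists>b. w \<oplus> a \<odot> v = u \<oplus> b \<odot> v)) = w"
      using inj that by (intro the_equality) blast+
    then show ?thesis by (simp add: P'_def)
  qed
  have ext: "w \<in> W' \<and> P' w = P w" if "w \<in> W" for w
  proof -
    have "w = w \<oplus> 0 \<odot> v" using Win[OF that] v by simp
    then show ?thesis using P'[OF that, of 0] that unfolding W'_def adjoin_def by auto
  qed
  have "v \<in> W'"
    unfolding W'_def adjoin_def using closed_subspace_zero[OF W] v
    by (intro CollectI exI[of _ \<zero>] exI[of _ 1]) simp
  have "linear_between (E\<lparr>carrier := W'\<rparr>) (E\<lparr>carrier := V\<rparr>) P'"
    unfolding linear_between_def
  proof (intro conjI ballI allI funcsetI)
    show "P' x \<in> carrier (E\<lparr>carrier := V\<rparr>)" if "x \<in> carrier (E\<lparr>carrier := W'\<rparr>)" for x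
      using that P' PV by (auto simp: W'_def adjoin_def)
    show "P' (x \<oplus>\<^bsub>E\<lparr>carrier := W'\<rparr>\<^esub> y) = P' x \<oplus>\<^bsub>E\<lparr>carrier := V\<rparr>\<^esub> P' y"
      if xy: "x \<in> carrier (E\<lparr>carrier := W'\<rparr>)" "y \<in> carrier (E\<lparr>carrier := W'\<rparr>)" for x y
    proof -
      obtain w a w' a' where e: "x = w \<oplus> a \<odot> v" "y = w' \<oplus> a' \<odot> v" "w \<in> W" "w' \<in> W"
        using xy by (auto simp: W'_def adjoin_def)
      then have "x \<oplus> y = (w \<oplus> w') \<oplus> (a + a') \<odot> v"
        using v Win by (simp add: smult_add_left M.a_ac)
      then show ?thesis
        using e closed_subspace_add[OF W] by (simp add: P' projection_mod_compact_add[OF P])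
    qed
    show "P' (a \<odot>\<^bsub>E\<lparr>carrier := W'\<rparr>\<^esub> x) = a \<odot>\<^bsub>E\<lparr>carrier := V\<rparr>\<^esub> P' x"
      if x: "x \<in> carrier (E\<lparr>carrier := W'\<rparr>)" for x a
    proof -
      obtain w b where e: "x = w \<oplus> b \<odot> v" "w \<in> W" using x by (auto simp: W'_def adjoin_def)
      then have "a \<odot> x = (a \<odot> w) \<oplus> (a * b) \<odot> v"
        using v Win by (simp add: smult_add_right smult_smult)
      then show ?thesis
        using e closed_subspace_smult[OF W] by (simp add: P' projection_mod_compact_smult[OF P])
    qed
  qed
  moreover have "\<exists>K. finite K \<and> K \<subseteq> carrier E \<and>
        (\<forall>y\<in>W'. nrm E y \<le> R \<longrightarrow> (\<exists>k\<in>K. nrm E ((y \<ominus> P' y) \<ominus> k) \<le> \<delta>))" if pos: "\<delta> > 0" for R \<delta>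
  proof -
    define B where "B = nrm E v"
    have B: "B \<ge> 0" using v by (simp add: B_def)
    obtain K where K: "finite K" "K \<subseteq> carrier E"
      "\<And>w. w \<in> W \<Longrightarrow> nrm E w \<le> R + R / d * B \<Longrightarrow> \<exists>k\<in>K. nrm E ((w \<ominus> P w) \<ominus> k) \<le> \<delta> / 2"
      using projection_mod_compact_nets[OF P, of "\<delta> / 2" "R + R / d * B"] pos by (meson half_gt_zero)
    have "\<forall>e>0. \<exists>A. finite A \<and> A \<subseteq> cball (0::'k) (R / d) \<and> cball 0 (R / d) \<subseteq> (\<Union>x\<in>A. ball x e)"
      by (rule seq_compact_imp_totally_bounded[OF compact_imp_seq_compact[OF compact_cball]])
    then obtain A where A: "finite A" "cball (0::'k) (R / d) \<subseteq> (\<Union>x\<in>A. ball x (\<delta> / 2 / (B + 1)))"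
      using pos B by (meson add_nonneg_pos divide_pos_pos zero_less_numeral zero_less_one)
    show ?thesis
    proof (intro exI[of _ "(\<lambda>(k, b). k \<oplus> b \<odot> v) ` (K \<times> A)"] conjI ballI impI)
      show "finite ((\<lambda>(k, b). k \<oplus> b \<odot> v) ` (K \<times> A))" using K(1) A(1) by simp
      show "(\<lambda>(k, b). k \<oplus> b \<odot> v) ` (K \<times> A) \<subseteq> carrier E" using K(2) v by auto
      fix y assume y: "y \<in> W'" "nrm E y \<le> R"
      then obtain w a where e: "y = w \<oplus> a \<odot> v" "w \<in> W" by (auto simp: W'_def adjoin_def)
      have "norm a * d \<le> R" using d(2)[OF e(2), of a] y e by simp
      then have a: "norm a \<le> R / d" using d(1) by (simp add: field_simps)
      then obtain b where b: "b \<in> A" "norm (a - b) < \<delta> / 2 / (B + 1)"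
        using A(2) by (auto simp: subset_iff dist_norm norm_minus_commute)
      have "nrm E w \<le> nrm E (w \<oplus> a \<odot> v) + nrm E (a \<odot> v)"
        using nrm_diff_le[of "w \<oplus> a \<odot> v" "a \<odot> v"] Win[OF e(2)] v by simp
      also have "\<dots> \<le> R + R / d * B"
        using y(2) e(1) v a B by (simp add: nrm_smult B_def[symmetric] add_mono mult_right_mono del: times_divide_eq_left)
      finally obtain k where k: "k \<in> K" "nrm E ((w \<ominus> P w) \<ominus> k) \<le> \<delta> / 2"
        using K(3) e(2) by blast
      have kc: "k \<in> carrier E" "w \<in> carrier E" "P w \<in> carrier E"
        using k K(2) Win[OF e(2)] Vin[OF PV[OF e(2)]] by auto
      have "(y \<ominus> P' y) \<ominus> (k \<oplus> b \<odot> v) = ((w \<ominus> P w) \<oplus> a \<odot> v) \<ominus> (k \<oplus> b \<odot> v)"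
        using kc v e by (simp add: P' M.minus_eq M.a_ac)
      also have "\<dots> = ((w \<ominus> P w) \<ominus> k) \<oplus> (a - b) \<odot> v"
        using kc v by (simp add: add_smult_diff)
      finally have "nrm E ((y \<ominus> P' y) \<ominus> (k \<oplus> b \<odot> v)) \<le> nrm E ((w \<ominus> P w) \<ominus> k) + norm (a - b) * B"
        using nrm_triangle[of "(w \<ominus> P w) \<ominus> k" "(a - b) \<odot> v"] kc v by (simp add: nrm_smult B_def)
      also have "norm (a - b) * B \<le> \<delta> / 2 / (B + 1) * (B + 1)"
        using b(2) B pos by (intro mult_mono) auto
      also have "\<dots> = \<delta> / 2" using B by (simp add: field_simps)
      finally have "nrm E ((y \<ominus> P' y) \<ominus> (k \<oplus> b \<odot> v)) \<le> \<delta>" using k(2) by simp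
      then show "\<exists>k\<in>(\<lambda>(k, b). k \<oplus> b \<odot> v) ` (K \<times> A). nrm E ((y \<ominus> P' y) \<ominus> k) \<le> \<delta>"
        using k(1) b(1) by (intro bexI[of _ "k \<oplus> b \<odot> v"]) auto
    qed
  qed
  ultimately have "projection_mod_compact V W' P'"
    unfolding projection_mod_compact_def using V W' VW ext Pid by (auto simp: subset_iff)
  then show ?thesis using ext \<open>v \<in> W'\<close> by blast
qed

text \<open>
  By compactness finitely many points \<open>n\<close> of the unit ball of \<open>W\<close> suffice to approximate
  every \<open>u - P u\<close>, for \<open>u\<close> in this ball, by some \<open>n - P n\<close>. From
  \<open>P u - P n = (u - n) + ((n - P n) - (u - P u))\<close> one gets \<open>\<parallel>P u - P n\<parallel> \<le> 2 + \<epsilon>/2\<close>. Pointwise convergence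
  to \<open>0\<close>, used at the finitely many points \<open>P n\<close>, supplies the remaining \<open>\<epsilon>/2\<close>.
\<close>

lemma eventually_compose_projection_bound:
  fixes Z :: "nat \<Rightarrow> ('k, 'b) normed_module" and T :: "nat \<Rightarrow> 'a \<Rightarrow> 'b"
  assumes P: "projection_mod_compact V W P"
    and Z: "\<And>j. normed_vector_space (Z j)"
    and T: "\<And>j. linear_between (E\<lparr>carrier := V\<rparr>) (Z j) (T j)"
    and bound: "\<And>j x. x \<in> V \<Longrightarrow> nrm (Z j) (T j x) \<le> M * nrm E x"
    and null: "\<And>x. x \<in> V \<Longrightarrow> (\<lambda>j. nrm (Z j) (T j x)) \<longlonglongrightarrow> 0"
    and "M \<ge> 0" "\<epsilon> > 0"
  shows "\<forall>\<^sub>F j in sequentially. \<forall>w\<in>W. nrm (Z j) (T j (P w)) \<le> (2 + \<epsilon>) * M * nrm E w"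
proof (cases "M = 0")
  case True
  then show ?thesis using bound projection_mod_compact_in[OF P] by simp
next
  case False
  then have M: "M > 0" using \<open>M \<ge> 0\<close> by simp
  note W = projection_mod_compact_dom[OF P] and PV = projection_mod_compact_in[OF P]
  note Win = closed_subspace_in[OF W]
  have V: "closed_subspace V E" and VW: "V \<subseteq> W"
    using P by (auto simp: projection_mod_compact_def)
  note Vin = closed_subspace_in[OF V]
  obtain K where K: "finite K" "K \<subseteq> carrier E"
      "\<And>w. w \<in> W \<Longrightarrow> nrm E w \<le> 1 \<Longrightarrow> \<exists>k\<in>K. nrm E ((w \<ominus> P w) \<ominus> k) \<le> \<epsilon> / 4"
    using projection_mod_compact_nets[OF P, of "\<epsilon> / 4" 1] \<open>\<epsilon> > 0\<close> by auto
  \<comment> \<open>The centres of the net lie anywhere in the space, so each one that is used is replaced by a nearby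
    point \<open>c k - P (c k)\<close> with \<open>c k\<close> in the unit ball; this doubles the distance \<open>\<epsilon> / 4\<close>.\<close>
  define near where "near k u \<longleftrightarrow> u \<in> W \<and> nrm E u \<le> 1 \<and> nrm E ((u \<ominus> P u) \<ominus> k) \<le> \<epsilon> / 4" for k u
  define K' where "K' = {k\<in>K. \<exists>u. near k u}"
  define c where "c k = (SOME u. near k u)" for k
  have c: "near k (c k)" if "k \<in> K'" for k
    using that unfolding K'_def c_def by (auto intro: someI_ex)
  have "\<forall>\<^sub>F j in sequentially. \<forall>k\<in>K'. nrm (Z j) (T j (P (c k))) < M * \<epsilon> / 2"
  proof (intro eventually_ball_finite ballI)
    show "finite K'" using K(1) by (simp add: K'_def)
    fix k assume "k \<in> K'"
    then have "P (c k) \<in> V" using c PV by (simp add: near_def)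
    from null[OF this] show "\<forall>\<^sub>F j in sequentially. nrm (Z j) (T j (P (c k))) < M * \<epsilon> / 2"
      by (rule order_tendstoD(2)) (use M \<open>\<epsilon> > 0\<close> in auto)
  qed
  then show ?thesis
  proof (rule eventually_mono, intro ballI)
    fix j w
    assume small: "\<forall>k\<in>K'. nrm (Z j) (T j (P (c k))) < M * \<epsilon> / 2" and w: "w \<in> W"
    have Tin: "T j x \<in> carrier (Z j)" if "x \<in> V" for x
      using linear_between_closed[OF T] that by simp
    have unit: "nrm (Z j) (T j (P u)) \<le> (2 + \<epsilon>) * M" if u: "u \<in> W" "nrm E u \<le> 1" for u
    proof -
      obtain k where k: "k \<in> K" "nrm E ((u \<ominus> P u) \<ominus> k) \<le> \<epsilon> / 4" using K(3)[OF u] by blast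
      then have k': "k \<in> K'" using u by (auto simp: K'_def near_def)
      define n where "n = c k"
      have n: "n \<in> W" "nrm E n \<le> 1" "nrm E ((n \<ominus> P n) \<ominus> k) \<le> \<epsilon> / 4"
        using c[OF k'] by (auto simp: near_def n_def)
      have cs: "u \<in> carrier E" "n \<in> carrier E" "P u \<in> carrier E" "P n \<in> carrier E" "k \<in> carrier E"
        using u n Win Vin PV k K(2) by auto
      have "nrm E (P u \<ominus> P n) \<le> nrm E (u \<ominus> n) + nrm E ((n \<ominus> P n) \<ominus> (u \<ominus> P u))"
      proof -
        have "P u \<ominus> P n = (u \<ominus> n) \<oplus> ((n \<ominus> P n) \<ominus> (u \<ominus> P u))"
        proof -
          have "(n \<ominus> P n) \<ominus> (u \<ominus> P u) = (n \<ominus> u) \<oplus> (P u \<ominus> P n)"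
            using cs by (simp add: M.minus_eq M.minus_add M.a_ac)
          then have "(u \<ominus> n) \<oplus> ((n \<ominus> P n) \<ominus> (u \<ominus> P u)) = (u \<ominus> n) \<oplus> ((n \<ominus> u) \<oplus> (P u \<ominus> P n))"
            by (simp only:)
          also have "\<dots> = ((u \<ominus> n) \<oplus> (n \<ominus> u)) \<oplus> (P u \<ominus> P n)"
            using cs by (intro M.a_assoc[symmetric]) auto
          also have "\<dots> = P u \<ominus> P n" using cs by simp
          finally show ?thesis ..
        qed
        then show ?thesis using nrm_triangle cs by simp
      qed
      also have "nrm E (u \<ominus> n) \<le> 2" using nrm_diff_le[of u n] cs u n by simp
      also have "nrm E ((n \<ominus> P n) \<ominus> (u \<ominus> P u)) \<le> \<epsilon> / 4 + \<epsilon> / 4"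
        using nrm_triangle_diff[of "n \<ominus> P n" k "u \<ominus> P u"] nrm_minus_commute[of "u \<ominus> P u" k] n k cs by simp
      finally have "nrm E (P u \<ominus> P n) \<le> 2 + \<epsilon> / 2" by simp
      then have "M * nrm E (P u \<ominus> P n) \<le> M * (2 + \<epsilon> / 2)" using M by simp
      moreover have "nrm (Z j) (T j (P u \<ominus> P n)) \<le> M * nrm E (P u \<ominus> P n)"
        by (rule bound[OF closed_subspace_diff[OF V PV[OF u(1)] PV[OF n(1)]]])
      moreover have "T j (P u \<ominus> P n) = T j (P u) \<ominus>\<^bsub>Z j\<^esub> T j (P n)"
        using linear_between_diff[OF normed_vector_space_restrict[OF V] Z T, of "P u" "P n" j]
          PV u n by (simp add: a_minus_restrict[OF V])
      moreover have "nrm (Z j) (T j (P u)) \<le> nrm (Z j) (T j (P u) \<ominus>\<^bsub>Z j\<^esub> T j (P n)) + nrm (Z j) (T j (P n))"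
        using normed_vector_space.nrm_le_diff[OF Z] Tin PV u n by simp
      moreover have "nrm (Z j) (T j (P n)) < M * \<epsilon> / 2"
        using small k' by (simp add: n_def)
      ultimately have "nrm (Z j) (T j (P u)) \<le> M * (2 + \<epsilon> / 2) + M * \<epsilon> / 2" by simp
      then show ?thesis by (simp add: algebra_simps)
    qed
    show "nrm (Z j) (T j (P w)) \<le> (2 + \<epsilon>) * M * nrm E w"
    proof (cases "w = \<zero>")
      case True
      have "P \<zero> = \<zero>"
        using projection_mod_compact_smult[OF P closed_subspace_zero[OF W], of 0]
          Vin[OF PV[OF closed_subspace_zero[OF W]]] by simp
      moreover have "T j \<zero> = \<zero>\<^bsub>Z j\<^esub>"
        using linear_between_zero[OF normed_vector_space_restrict[OF V] Z T, of j] by simp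
      ultimately show ?thesis using True by (simp add: normed_vector_space.nrm_zero[OF Z])
    next
      case False
      define r where "r = nrm E w"
      have r: "r > 0" using False nrm_nonneg[OF Win[OF w]] nrm_eq_0_iff[OF Win[OF w]] unfolding r_def by linarith
      have "nrm E (of_real (1 / r) \<odot> w) = 1" using r Win[OF w] by (simp add: nrm_smult norm_divide r_def[symmetric])
      then have "nrm (Z j) (T j (P (of_real (1 / r) \<odot> w))) \<le> (2 + \<epsilon>) * M"
        using unit closed_subspace_smult[OF W w] by simp
      moreover have "T j (P (of_real (1 / r) \<odot> w)) = of_real (1 / r) \<odot>\<^bsub>Z j\<^esub> T j (P w)"
        using linear_between_smult[OF T[of j], where x = "P w" and a = "of_real (1 / r)"] PV[OF w]
        by (simp add: projection_mod_compact_smult[OF P w])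
      ultimately have "nrm (Z j) (T j (P w)) / r \<le> (2 + \<epsilon>) * M"
        using Tin[OF PV[OF w]] r by (simp add: normed_vector_space.nrm_smult[OF Z] norm_divide)
      then show ?thesis using r by (simp add: r_def[symmetric] field_simps)
    qed
  qed
qed

end

section \<open>Independence of the type that carries the separable space\<close>

definition push_forward ::
  "('y \<Rightarrow> 'x) \<Rightarrow> ('k, 'y) normed_module \<Rightarrow> ('k, 'x) normed_module" where
  "push_forward f Y = (let g = inv_into (carrier Y) f in
     \<lparr>carrier = f ` carrier Y, monoid.mult = undefined, one = undefined,
      zero = f \<zero>\<^bsub>Y\<^esub>,
      add = (\<lambda>p q. f (g p \<oplus>\<^bsub>Y\<^esub> g q)),
      smult = (\<lambda>a p. f (a \<odot>\<^bsub>Y\<^esub> g p)),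
      nrm = (\<lambda>p. nrm Y (g p))\<rparr>)"

lemma push_forward_simps [simp]:
  "carrier (push_forward f Y) = f ` carrier Y"
  "\<zero>\<^bsub>push_forward f Y\<^esub> = f \<zero>\<^bsub>Y\<^esub>"
  "inj_on f (carrier Y) \<Longrightarrow> x \<in> carrier Y \<Longrightarrow> y \<in> carrier Y \<Longrightarrow>
     f x \<oplus>\<^bsub>push_forward f Y\<^esub> f y = f (x \<oplus>\<^bsub>Y\<^esub> y)"
  "inj_on f (carrier Y) \<Longrightarrow> x \<in> carrier Y \<Longrightarrow> a \<odot>\<^bsub>push_forward f Y\<^esub> f x = f (a \<odot>\<^bsub>Y\<^esub> x)"
  "inj_on f (carrier Y) \<Longrightarrow> x \<in> carrier Y \<Longrightarrow> nrm (push_forward f Y) (f x) = nrm Y x"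
  by (simp_all add: push_forward_def Let_def)

context normed_vector_space
begin

lemma normed_vector_space_push_forward:
  assumes inj: "inj_on f (carrier E)"
  shows "normed_vector_space (push_forward f E)"
proof (rule normed_vector_spaceI, goal_cases)
  case (7 x)
  then show ?case using inj smult_add_left[of _ "-1" 1] by auto
next
  case (12 x)
  then show ?case using inj by (auto simp: nrm_eq_0_iff inj_on_eq_iff[OF inj])
qed (use inj in \<open>auto simp: M.a_ac smult_add_left smult_add_right smult_smult nrm_triangle nrm_smult\<close>)

lemma linear_between_push_forward:
  "inj_on f (carrier E) \<Longrightarrow> linear_between E (push_forward f E) f"
  by (auto simp: linear_between_def)

lemma nrm_push_forward_diff:
  assumes inj: "inj_on f (carrier E)" and x: "x \<in> carrier E" "y \<in> carrier E"
  shows "nrm (push_forward f E) (f x \<ominus>\<^bsub>push_forward f E\<^esub> f y) = nrm E (x \<ominus> y)"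
proof -
  have "f (x \<ominus> y) = f x \<ominus>\<^bsub>push_forward f E\<^esub> f y"
    by (rule linear_between_diff[OF normed_vector_space_axioms normed_vector_space_push_forward[OF inj]
          linear_between_push_forward[OF inj] x])
  then show ?thesis using inj x by (metis push_forward_simps(5) M.minus_closed)
qed

lemma banach_space_push_forward:
  assumes inj: "inj_on f (carrier E)" and ban: "banach_space E"
  shows "banach_space (push_forward f E)"
proof -
  interpret P: normed_vector_space "push_forward f E" by (rule normed_vector_space_push_forward[OF inj])
  note dist = nrm_push_forward_diff[OF inj]
  have "Metric_space.mcomplete (carrier (push_forward f E)) (ndist (push_forward f E))"
    unfolding P.mcomplete_iff_nrm
  proof (intro allI impI)
    fix s :: "nat \<Rightarrow> 'b"
    assume s: "range s \<subseteq> carrier (push_forward f E)"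
      and cauchy: "\<forall>e>0. \<exists>N. \<forall>m\<ge>N. \<forall>n\<ge>N. nrm (push_forward f E) (s m \<ominus>\<^bsub>push_forward f E\<^esub> s n) < e"
    from s have "\<forall>n. \<exists>x\<in>carrier E. s n = f x" by auto
    then obtain t where t: "\<And>n. t n \<in> carrier E" "\<And>n. s n = f (t n)" by metis
    obtain l where "l \<in> carrier E" "(\<lambda>n. nrm E (t n \<ominus> l)) \<longlonglongrightarrow> 0"
    proof -
      have "range t \<subseteq> carrier E" using t by auto
      moreover have "\<forall>e>0. \<exists>N. \<forall>m\<ge>N. \<forall>n\<ge>N. nrm E (t m \<ominus> t n) < e"
        using cauchy t by (simp add: dist)
      ultimately show ?thesis
        using that ban unfolding banach_space_def mcomplete_iff_nrm by blast
    qed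
    then show "\<exists>l\<in>carrier (push_forward f E).
        (\<lambda>n. nrm (push_forward f E) (s n \<ominus>\<^bsub>push_forward f E\<^esub> l)) \<longlonglongrightarrow> 0"
      using t by (auto simp: dist)
  qed
  then show ?thesis unfolding banach_space_def using P.normed_vector_space_axioms by blast
qed

lemma separable_push_forward:
  assumes inj: "inj_on f (carrier E)" and sep: "separable_space (ntopology E)"
  shows "separable_space (ntopology (push_forward f E))"
proof -
  interpret P: normed_vector_space "push_forward f E" by (rule normed_vector_space_push_forward[OF inj])
  obtain d :: "nat \<Rightarrow> 'a" where d: "range d \<subseteq> carrier E"
    "\<And>x e. x \<in> carrier E \<Longrightarrow> e > 0 \<Longrightarrow> \<exists>n. nrm E (x \<ominus> d n) < e"
    using sep unfolding separable_iff_nrm by blast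
  have "d n \<in> carrier E" for n using d(1) by auto
  then show ?thesis
    unfolding P.separable_iff_nrm using d
    by (intro exI[of _ "f \<circ> d"]) (auto simp: nrm_push_forward_diff[OF inj])
qed

lemma closed_subspace_push_forward:
  assumes inj: "inj_on f (carrier E)" and V: "closed_subspace V E"
  shows "closed_subspace (f ` V) (push_forward f E)"
proof -
  interpret P: normed_vector_space "push_forward f E" by (rule normed_vector_space_push_forward[OF inj])
  note Vin = closed_subspace_in[OF V]
  have "\<exists>r>0. \<forall>y\<in>f ` V. r \<le> nrm (push_forward f E) (p \<ominus>\<^bsub>push_forward f E\<^esub> y)"
    if p: "p \<in> carrier (push_forward f E) - f ` V" for p
  proof -
    obtain x where x: "p = f x" "x \<in> carrier E" "x \<notin> V" using p by auto
    then show ?thesis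
      using closed_subspace_gap[OF V x(2,3)] Vin by (auto simp: nrm_push_forward_diff[OF inj])
  qed
  then show ?thesis
    unfolding closed_subspace_def P.submodule_iff P.closedin_iff_nrm
    using Vin closed_subspace_zero[OF V] closed_subspace_add[OF V] closed_subspace_smult[OF V] inj
    by auto
qed

text \<open>
  A point is determined by its distances to the terms of a dense sequence.
\<close>

lemma separating_sequence:
  assumes "separable_space (ntopology E)"
  shows "\<exists>f :: 'a \<Rightarrow> nat \<Rightarrow> real. inj_on f (carrier E)"
proof -
  obtain d :: "nat \<Rightarrow> 'a" where d: "range d \<subseteq> carrier E"
    "\<And>x e. x \<in> carrier E \<Longrightarrow> e > 0 \<Longrightarrow> \<exists>n. nrm E (x \<ominus> d n) < e"
    using assms unfolding separable_iff_nrm by blast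
  have "inj_on (\<lambda>x n. nrm E (x \<ominus> d n)) (carrier E)"
  proof (rule inj_onI, rule ccontr)
    fix x y assume x: "x \<in> carrier E" and y: "y \<in> carrier E" and ne: "x \<noteq> y"
      and eq: "(\<lambda>n. nrm E (x \<ominus> d n)) = (\<lambda>n. nrm E (y \<ominus> d n))"
    have "nrm E (x \<ominus> y) > 0"
      using x y ne by (metis diff_eq_zero_iff nrm_eq_0_iff nrm_nonneg less_eq_real_def M.minus_closed)
    then obtain n where n: "nrm E (x \<ominus> d n) < nrm E (x \<ominus> y) / 2"
      using d(2)[OF x, of "nrm E (x \<ominus> y) / 2"] by auto
    have "d n \<in> carrier E" using d(1) by auto
    then have "nrm E (x \<ominus> y) \<le> nrm E (x \<ominus> d n) + nrm E (y \<ominus> d n)"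
      using nrm_triangle_diff[of x "d n" y] nrm_minus_commute[of "d n" y] x y by simp
    then show False using n fun_cong[OF eq, of n] by simp
  qed
  then show ?thesis by blast
qed

lemma extend_operator_via_injection:
  fixes f :: "'a \<Rightarrow> 'x" and Z :: "('k, 'b) normed_module"
  assumes SEP: "has_SEP TYPE('x) lam Z" and inj: "inj_on f (carrier E)"
    and E: "banach_space E" "separable_space (ntopology E)" and V: "closed_subspace V E"
    and T: "bounded_operator (E\<lparr>carrier := V\<rparr>) Z T"
  shows "\<exists>T'. bounded_operator E Z T' \<and> (\<forall>x\<in>V. T' x = T x) \<and>
           opnorm E Z T' \<le> lam * opnorm (E\<lparr>carrier := V\<rparr>) Z T"
proof -
  define F where "F = push_forward f E"
  define g where "g = inv_into (carrier E) f"
  have g [simp]: "g (f x) = x" if "x \<in> carrier E" for x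
    using inj that by (simp add: g_def)
  note Vin = closed_subspace_in[OF V]
  have F: "banach_space F" "separable_space (ntopology F)" "closed_subspace (f ` V) F"
    unfolding F_def using banach_space_push_forward[OF inj E(1)] separable_push_forward[OF inj E(2)]
      closed_subspace_push_forward[OF inj V] by auto
  have "bounded_operator (F\<lparr>carrier := f ` V\<rparr>) Z (T \<circ> g)"
    using T inj Vin closed_subspace_add[OF V] closed_subspace_smult[OF V]
    unfolding bounded_operator_def F_def by (auto simp: Pi_iff)
  then obtain S where S: "bounded_operator F Z S" "\<And>x. x \<in> f ` V \<Longrightarrow> S x = (T \<circ> g) x"
      "opnorm F Z S \<le> lam * opnorm (F\<lparr>carrier := f ` V\<rparr>) Z (T \<circ> g)"
    using SEP F unfolding has_SEP_def by blast
  have nrm_F: "nrm F (f x) = nrm E x" if "x \<in> carrier E" for x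
    using that inj by (simp add: F_def)
  have "{p \<in> f ` U. nrm F p \<le> 1} = f ` {x \<in> U. nrm E x \<le> 1}" if "U \<subseteq> carrier E" for U
    using that by (auto simp: nrm_F subset_iff)
  from this[of "carrier E"] this[OF closed_subspace_subset[OF V]]
  have "opnorm E Z (S \<circ> f) = opnorm F Z S"
    and "opnorm (F\<lparr>carrier := f ` V\<rparr>) Z (T \<circ> g) = opnorm (E\<lparr>carrier := V\<rparr>) Z T"
    using Vin by (auto simp: opnorm_def image_image F_def intro!: SUP_cong)
  moreover have "bounded_operator E Z (S \<circ> f)"
    using S(1) inj unfolding bounded_operator_def F_def by (auto simp: Pi_iff)
  ultimately show ?thesis
    using S(2,3) Vin by (intro exI[of _ "S \<circ> f"]) auto
qed

end

text \<open>
  A separable space embeds into \<open>nat \<Rightarrow> real\<close> as a set, and the isometric copy on the image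
  has the same operators, subspaces and operator norms.
\<close>

lemma has_SEP_any_type:
  fixes Z :: "('k::{real_normed_field, euclidean_space}, 'a) normed_module"
  assumes "has_SEP TYPE(nat \<Rightarrow> real) lam Z"
  shows "has_SEP TYPE('y) lam Z"
  unfolding has_SEP_def
proof (intro conjI allI impI)
  show "banach_space Z" using assms by (simp add: has_SEP_def)
next
  fix Y :: "('k, 'y) normed_module" and V T
  assume *: "banach_space Y \<and> separable_space (ntopology Y) \<and> closed_subspace V Y \<and>
    bounded_operator (Y\<lparr>carrier := V\<rparr>) Z T"
  then have Y: "normed_vector_space Y" by (simp add: banach_space_def)
  obtain f :: "'y \<Rightarrow> nat \<Rightarrow> real" where "inj_on f (carrier Y)"
    using normed_vector_space.separating_sequence[OF Y] * by blast
  then show "\<exists>T'. bounded_operator Y Z T' \<and> (\<forall>x\<in>V. T' x = T x) \<and>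
              opnorm Y Z T' \<le> lam * opnorm (Y\<lparr>carrier := V\<rparr>) Z T"
    using normed_vector_space.extend_operator_via_injection[OF Y assms] * by blast
qed

section \<open>The space of null sequences\<close>

lemma c0_sum_simps [simp]:
  "carrier (c0_sum Z) = {z. (\<forall>j. z j \<in> carrier (Z j)) \<and> (\<lambda>j. nrm (Z j) (z j)) \<longlonglongrightarrow> 0}"
  "\<zero>\<^bsub>c0_sum Z\<^esub> = (\<lambda>j. \<zero>\<^bsub>Z j\<^esub>)"
  "z \<oplus>\<^bsub>c0_sum Z\<^esub> w = (\<lambda>j. z j \<oplus>\<^bsub>Z j\<^esub> w j)"
  "a \<odot>\<^bsub>c0_sum Z\<^esub> z = (\<lambda>j. a \<odot>\<^bsub>Z j\<^esub> z j)"
  "nrm (c0_sum Z) z = (SUP j. nrm (Z j) (z j))"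
  by (simp_all add: c0_sum_def)

lemma nrm_coord_le_c0_sum:
  assumes "z \<in> carrier (c0_sum Z)"
  shows "nrm (Z j) (z j) \<le> nrm (c0_sum Z) z"
proof -
  have "bdd_above (range (\<lambda>j. nrm (Z j) (z j)))"
    using assms by (auto intro!: convergent_imp_Bseq Bseq_bdd_above simp: convergent_def)
  from cSUP_upper[OF UNIV_I this, of j] show ?thesis by simp
qed

lemma nrm_c0_sum_le: "(\<And>j. nrm (Z j) (z j) \<le> K) \<Longrightarrow> nrm (c0_sum Z) z \<le> K"
  by (simp add: cSUP_least)

lemma normed_vector_space_c0_sum:
  fixes Z :: "nat \<Rightarrow> ('k::{real_normed_field, euclidean_space}, 'a) normed_module"
  assumes Z: "\<And>j. normed_vector_space (Z j)"
  shows "normed_vector_space (c0_sum Z)"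
proof -
  interpret Z: normed_vector_space "Z j" for j by (rule Z)
  have smult_le: "nrm (c0_sum Z) (a \<odot>\<^bsub>c0_sum Z\<^esub> x) \<le> norm a * nrm (c0_sum Z) x"
    if "x \<in> carrier (c0_sum Z)" for a x
    using that nrm_coord_le_c0_sum[OF that]
    by (intro nrm_c0_sum_le) (simp add: Z.nrm_smult mult_left_mono del: c0_sum_simps(5))
  have add_closed: "x \<oplus>\<^bsub>c0_sum Z\<^esub> y \<in> carrier (c0_sum Z)"
    if "x \<in> carrier (c0_sum Z)" "y \<in> carrier (c0_sum Z)" for x y
  proof -
    have "(\<lambda>j. nrm (Z j) (x j) + nrm (Z j) (y j)) \<longlonglongrightarrow> 0 + 0"
      using that by (intro tendsto_add) simp_all
    then have "(\<lambda>j. nrm (Z j) (x j) + nrm (Z j) (y j)) \<longlonglongrightarrow> 0" by simp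
    moreover have "\<forall>\<^sub>F j in sequentially. norm (nrm (Z j) (x j \<oplus>\<^bsub>Z j\<^esub> y j)) \<le> nrm (Z j) (x j) + nrm (Z j) (y j)"
      using that by (intro always_eventually allI) (simp add: Z.nrm_triangle)
    ultimately have "(\<lambda>j. nrm (Z j) (x j \<oplus>\<^bsub>Z j\<^esub> y j)) \<longlonglongrightarrow> 0"
      by (rule Lim_null_comparison[rotated])
    then show ?thesis using that by simp
  qed
  have smult_closed: "a \<odot>\<^bsub>c0_sum Z\<^esub> x \<in> carrier (c0_sum Z)" if "x \<in> carrier (c0_sum Z)" for a x
    using that by (simp add: Z.nrm_smult tendsto_mult_right_zero)
  show ?thesis
  proof (rule normed_vector_spaceI, goal_cases)
    case (2 x y) then show ?case by (rule add_closed)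
  next
    case (3 a x) then show ?case by (rule smult_closed)
  next
    case (7 x)
    have "(-1) \<odot>\<^bsub>Z j\<^esub> x j \<oplus>\<^bsub>Z j\<^esub> x j = \<zero>\<^bsub>Z j\<^esub>" for j
      using 7 Z.smult_add_left[of "x j" j "-1" 1] by simp
    then show ?case by simp
  next
    case (12 x)
    show ?case
    proof
      assume "nrm (c0_sum Z) x = 0"
      then have "nrm (Z j) (x j) = 0" for j
        using nrm_coord_le_c0_sum[OF 12, of j] 12 Z.nrm_nonneg[of "x j" j]
        by (simp add: order_antisym)
      then show "x = \<zero>\<^bsub>c0_sum Z\<^esub>" using 12 by (auto simp: Z.nrm_eq_0_iff)
    qed simp
  next
    case (13 x y)
    show ?case
    proof (rule nrm_c0_sum_le)
      fix j
      have "nrm (Z j) (x j \<oplus>\<^bsub>Z j\<^esub> y j) \<le> nrm (Z j) (x j) + nrm (Z j) (y j)"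
        using 13 by (auto intro: Z.nrm_triangle)
      then show "nrm (Z j) ((x \<oplus>\<^bsub>c0_sum Z\<^esub> y) j) \<le> nrm (c0_sum Z) x + nrm (c0_sum Z) y"
        using nrm_coord_le_c0_sum[OF 13(1), of j] nrm_coord_le_c0_sum[OF 13(2), of j]
        by (simp del: c0_sum_simps(5))
    qed
  next
    case (14 a x)
    show ?case
    proof (cases "a = 0")
      case True
      then show ?thesis using 14 by simp
    next
      case False
      have "(1 / a) \<odot>\<^bsub>c0_sum Z\<^esub> (a \<odot>\<^bsub>c0_sum Z\<^esub> x) = x"
        using 14 False by (auto simp: Z.smult_smult)
      then have "nrm (c0_sum Z) x \<le> norm (1 / a) * nrm (c0_sum Z) (a \<odot>\<^bsub>c0_sum Z\<^esub> x)"
        using smult_le[OF smult_closed[OF 14], of "1 / a" a] by (simp del: c0_sum_simps)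
      then have "norm a * nrm (c0_sum Z) x \<le> nrm (c0_sum Z) (a \<odot>\<^bsub>c0_sum Z\<^esub> x)"
        using False by (simp add: norm_divide field_simps del: c0_sum_simps)
      then show ?thesis using smult_le[OF 14, of a] by (simp del: c0_sum_simps)
    qed
  qed (auto simp: Z.M.a_ac Z.smult_add_left Z.smult_add_right Z.smult_smult)
qed

lemma c0_sum_diff:
  assumes Z: "\<And>j. normed_vector_space (Z j)"
    and x: "x \<in> carrier (c0_sum Z)" "y \<in> carrier (c0_sum Z)"
  shows "x \<ominus>\<^bsub>c0_sum Z\<^esub> y = (\<lambda>j. x j \<ominus>\<^bsub>Z j\<^esub> y j)"
  using normed_vector_space.a_minus_eq_smult[OF normed_vector_space_c0_sum[OF Z] x]
    normed_vector_space.a_minus_eq_smult[OF Z] x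
  by simp

text \<open>
  Completeness of the coordinate spaces gives a limit \<open>l\<close> in each coordinate. The Cauchy condition is uniform in
  the coordinate, so the convergence is uniform as well; hence \<open>l\<close> is again a null sequence and is the
  limit in the supremum norm.
\<close>

lemma banach_space_c0_sum:
  fixes Z :: "nat \<Rightarrow> ('k::{real_normed_field, euclidean_space}, 'a) normed_module"
  assumes Z: "\<And>j. banach_space (Z j)"
  shows "banach_space (c0_sum Z)"
proof -
  have nvs: "normed_vector_space (Z j)" for j using Z by (simp add: banach_space_def)
  interpret Z: normed_vector_space "Z j" for j by (rule nvs)
  interpret C: normed_vector_space "c0_sum Z" by (rule normed_vector_space_c0_sum[OF nvs])
  note diff = c0_sum_diff[OF nvs]
  have "Metric_space.mcomplete (carrier (c0_sum Z)) (ndist (c0_sum Z))"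
    unfolding C.mcomplete_iff_nrm
  proof (intro allI impI)
    fix s :: "nat \<Rightarrow> nat \<Rightarrow> 'a"
    assume s: "range s \<subseteq> carrier (c0_sum Z)"
      and cauchy: "\<forall>e>0. \<exists>N. \<forall>m\<ge>N. \<forall>n\<ge>N. nrm (c0_sum Z) (s m \<ominus>\<^bsub>c0_sum Z\<^esub> s n) < e"
    have sc: "s n \<in> carrier (c0_sum Z)" for n using s by auto
    then have scj: "s n j \<in> carrier (Z j)" for n j by simp
    have coord: "nrm (Z j) (s m j \<ominus>\<^bsub>Z j\<^esub> s n j) \<le> nrm (c0_sum Z) (s m \<ominus>\<^bsub>c0_sum Z\<^esub> s n)" for m n j
      using nrm_coord_le_c0_sum[OF C.M.minus_closed[OF sc[of m] sc[of n]], where j = j] by (simp only: diff[OF sc sc])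
    have "\<exists>l\<in>carrier (Z j). (\<lambda>n. nrm (Z j) (s n j \<ominus>\<^bsub>Z j\<^esub> l)) \<longlonglongrightarrow> 0" for j
    proof -
      have "\<forall>e>0. \<exists>N. \<forall>m\<ge>N. \<forall>n\<ge>N. nrm (Z j) (s m j \<ominus>\<^bsub>Z j\<^esub> s n j) < e"
        using cauchy coord by (meson le_less_trans)
      moreover have "range (\<lambda>n. s n j) \<subseteq> carrier (Z j)" using scj by auto
      ultimately show ?thesis
        using Z[of j] unfolding banach_space_def Z.mcomplete_iff_nrm by blast
    qed
    then obtain l where l: "\<And>j. l j \<in> carrier (Z j)"
        "\<And>j. (\<lambda>n. nrm (Z j) (s n j \<ominus>\<^bsub>Z j\<^esub> l j)) \<longlonglongrightarrow> 0" by metis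
    have unif: "\<exists>N. \<forall>n\<ge>N. \<forall>j. nrm (Z j) (s n j \<ominus>\<^bsub>Z j\<^esub> l j) \<le> e" if e: "e > 0" for e
    proof -
      obtain N where N: "\<And>m n. m \<ge> N \<Longrightarrow> n \<ge> N \<Longrightarrow> nrm (c0_sum Z) (s m \<ominus>\<^bsub>c0_sum Z\<^esub> s n) < e"
        using cauchy e by blast
      have "nrm (Z j) (s n j \<ominus>\<^bsub>Z j\<^esub> l j) \<le> e" if n: "n \<ge> N" for n j
      proof -
        have "nrm (Z j) (s n j \<ominus>\<^bsub>Z j\<^esub> l j) \<le> e + nrm (Z j) (s m j \<ominus>\<^bsub>Z j\<^esub> l j)" if "m \<ge> N" for m
          using Z.nrm_triangle_diff[of "s n j" j "s m j" "l j"] scj l(1) coord[of j n m] N[OF n that] by simp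
        moreover have "(\<lambda>m. e + nrm (Z j) (s m j \<ominus>\<^bsub>Z j\<^esub> l j)) \<longlonglongrightarrow> e + 0"
          by (intro tendsto_intros l)
        ultimately have "nrm (Z j) (s n j \<ominus>\<^bsub>Z j\<^esub> l j) \<le> e + 0"
          by (intro LIMSEQ_le_const) auto
        then show ?thesis by simp
      qed
      then show ?thesis by blast
    qed
    have "(\<lambda>j. nrm (Z j) (l j)) \<longlonglongrightarrow> 0"
    proof (rule LIMSEQ_I)
      fix e :: real assume e: "e > 0"
      obtain N where N: "\<And>j. nrm (Z j) (s N j \<ominus>\<^bsub>Z j\<^esub> l j) \<le> e / 2" using unif[of "e / 2"] e by auto
      have "(\<lambda>j. nrm (Z j) (s N j)) \<longlonglongrightarrow> 0" using sc[of N] by simp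
      from LIMSEQ_D[OF this half_gt_zero[OF e]]
      obtain J where J: "\<And>j. j \<ge> J \<Longrightarrow> norm (nrm (Z j) (s N j) - 0) < e / 2" by blast
      have "norm (nrm (Z j) (l j) - 0) < e" if "j \<ge> J" for j
        using J[OF that] N[of j] Z.nrm_le_diff[of "l j" j "s N j"] Z.nrm_minus_commute[of "l j" j "s N j"]
          l(1)[of j] scj[of N j] by simp
      then show "\<exists>J. \<forall>j\<ge>J. norm (nrm (Z j) (l j) - 0) < e" by blast
    qed
    then have lc: "l \<in> carrier (c0_sum Z)" using l(1) by simp
    have "(\<lambda>n. nrm (c0_sum Z) (s n \<ominus>\<^bsub>c0_sum Z\<^esub> l)) \<longlonglongrightarrow> 0"
    proof (rule LIMSEQ_I)
      fix e :: real assume e: "e > 0"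
      obtain N where N: "\<And>n j. n \<ge> N \<Longrightarrow> nrm (Z j) (s n j \<ominus>\<^bsub>Z j\<^esub> l j) \<le> e / 2" using unif[of "e / 2"] e by auto
      have "norm (nrm (c0_sum Z) (s n \<ominus>\<^bsub>c0_sum Z\<^esub> l) - 0) < e" if "n \<ge> N" for n
      proof -
        have "nrm (c0_sum Z) (s n \<ominus>\<^bsub>c0_sum Z\<^esub> l) \<le> e / 2"
          using N[OF that] by (intro nrm_c0_sum_le) (simp add: diff[OF sc lc])
        then show ?thesis
          using C.nrm_nonneg[OF C.M.minus_closed[OF sc lc], of n] e by (simp del: c0_sum_simps)
      qed
      then show "\<exists>N. \<forall>n\<ge>N. norm (nrm (c0_sum Z) (s n \<ominus>\<^bsub>c0_sum Z\<^esub> l) - 0) < e" by blast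
    qed
    then show "\<exists>l\<in>carrier (c0_sum Z). (\<lambda>n. nrm (c0_sum Z) (s n \<ominus>\<^bsub>c0_sum Z\<^esub> l)) \<longlonglongrightarrow> 0"
      using lc by blast
  qed
  then show ?thesis unfolding banach_space_def using C.normed_vector_space_axioms by blast
qed

section \<open>Extending a pointwise null sequence of operators\<close>

lemma has_SEP_1_extend:
  fixes Y :: "('k::{real_normed_field, euclidean_space}, 'y) normed_module"
  assumes SEP: "has_SEP TYPE('y) 1 Z"
    and Y: "banach_space Y" "separable_space (ntopology Y)" and W: "closed_subspace W Y"
    and G: "linear_between (Y\<lparr>carrier := W\<rparr>) Z G"
    and K: "K \<ge> 0" "\<And>w. w \<in> W \<Longrightarrow> nrm Z (G w) \<le> K * nrm Y w"
  shows "\<exists>G'. linear_between Y Z G' \<and> (\<forall>w\<in>W. G' w = G w) \<and>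
           (\<forall>y\<in>carrier Y. nrm Z (G' y) \<le> K * nrm Y y)"
proof -
  have nY: "normed_vector_space Y" and nZ: "normed_vector_space Z"
    using Y SEP by (auto simp: banach_space_def has_SEP_def)
  note nW = normed_vector_space.normed_vector_space_restrict[OF nY W]
  have "bounded_operator (Y\<lparr>carrier := W\<rparr>) Z G"
    using G K(2) by (auto simp: bounded_operator_iff_linear)
  then obtain G' where G': "bounded_operator Y Z G'" "\<forall>w\<in>W. G' w = G w"
      "opnorm Y Z G' \<le> 1 * opnorm (Y\<lparr>carrier := W\<rparr>) Z G"
    using SEP Y W unfolding has_SEP_def by blast
  have "opnorm (Y\<lparr>carrier := W\<rparr>) Z G \<le> K"
    by (rule opnorm_le[OF nW K(1)]) (use K(2) in simp)
  then have le: "opnorm Y Z G' \<le> K" using G'(3) by simp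
  have "nrm Z (G' y) \<le> K * nrm Y y" if y: "y \<in> carrier Y" for y
  proof -
    have "nrm Z (G' y) \<le> opnorm Y Z G' * nrm Y y" by (rule nrm_le_opnorm[OF nY nZ G'(1) y])
    also have "\<dots> \<le> K * nrm Y y"
      by (rule mult_right_mono[OF le normed_vector_space.nrm_nonneg[OF nY y]])
    finally show ?thesis .
  qed
  then show ?thesis using G'(1,2) unfolding bounded_operator_iff_linear by blast
qed

text \<open>
  The spaces and projections are chosen recursively: at step \<open>n\<close> the vector \<open>d n\<close> is adjoined by
  \<open>projection_mod_compact_extend\<close>. The projections extend each other, so a vector keeps the same image
  under all later ones.
\<close>

lemma (in normed_vector_space) projection_chain:
  fixes d :: "nat \<Rightarrow> 'a"
  assumes V: "closed_subspace V E" and d: "\<And>n. d n \<in> carrier E"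
  obtains W P where "\<And>n. projection_mod_compact V (W n) (P n)"
    and "W 0 = V" "\<And>x. P 0 x = x"
    and "\<And>n. d n \<in> W (Suc n)"
    and "\<And>m n w. m \<le> n \<Longrightarrow> w \<in> W m \<Longrightarrow> w \<in> W n \<and> P n w = P m w"
proof -
  have "\<exists>S. \<forall>n. (projection_mod_compact V (fst (S n)) (snd (S n)) \<and> (n = 0 \<longrightarrow> S n = (V, \<lambda>x. x))) \<and>
    (fst (S n) \<subseteq> fst (S (Suc n)) \<and> d n \<in> fst (S (Suc n)) \<and> (\<forall>w\<in>fst (S n). snd (S (Suc n)) w = snd (S n) w))"
  proof (rule dependent_nat_choice, goal_cases)
    case 1
    show ?case using projection_mod_compact_id[OF V] by (intro exI[of _ "(V, \<lambda>x. x)"]) simp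
  next
    case (2 S n)
    then obtain W' P' where "projection_mod_compact V W' P'" "fst S \<subseteq> W'" "d n \<in> W'"
        "\<forall>w\<in>fst S. P' w = snd S w"
      using projection_mod_compact_extend[OF _ d] by blast
    then show ?case by (intro exI[of _ "(W', P')"]) simp
  qed
  then obtain S where S: "\<And>n. projection_mod_compact V (fst (S n)) (snd (S n))" "S 0 = (V, \<lambda>x. x)"
      "\<And>n. fst (S n) \<subseteq> fst (S (Suc n))" "\<And>n. d n \<in> fst (S (Suc n))"
      "\<And>n w. w \<in> fst (S n) \<Longrightarrow> snd (S (Suc n)) w = snd (S n) w"
    by blast
  have "w \<in> fst (S n) \<and> snd (S n) w = snd (S m) w" if "m \<le> n" "w \<in> fst (S m)" for m n w
    using that(1)
  proof (induction n rule: dec_induct)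
    case (step n)
    then show ?case using S(3)[of n] S(5)[of w n] by auto
  qed (use that in simp)
  then show thesis using S by (intro that[of "\<lambda>n. fst (S n)" "\<lambda>n. snd (S n)"]) auto
qed

text \<open>
  This is the theorem in coordinates. The stage of the chain on which \<open>G\<^sub>j\<close> is prescribed is the largest one
  up to \<open>j\<close> that the bound \<open>(2 + \<epsilon>) M\<close> permits. Since every stage satisfies the bound from some \<open>j\<close> on,
  the chosen stage tends to infinity, and convergence to \<open>0\<close> on the dense union of the stages spreads to
  the whole space by the uniform bound.
\<close>

lemma (in normed_vector_space) extend_null_sequence:
  fixes Z :: "nat \<Rightarrow> ('k, 'b) normed_module" and T :: "nat \<Rightarrow> 'a \<Rightarrow> 'b"
  assumes SEP: "\<And>j. has_SEP TYPE('a) 1 (Z j)"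
    and E: "banach_space E" "separable_space (ntopology E)" and V: "closed_subspace V E"
    and T: "\<And>j. linear_between (E\<lparr>carrier := V\<rparr>) (Z j) (T j)"
    and bound: "\<And>j x. x \<in> V \<Longrightarrow> nrm (Z j) (T j x) \<le> M * nrm E x"
    and null: "\<And>x. x \<in> V \<Longrightarrow> (\<lambda>j. nrm (Z j) (T j x)) \<longlonglongrightarrow> 0"
    and "M \<ge> 0" "\<epsilon> > 0"
  shows "\<exists>G. (\<forall>j. linear_between E (Z j) (G j)) \<and> (\<forall>j. \<forall>x\<in>V. G j x = T j x) \<and>
           (\<forall>j. \<forall>y\<in>carrier E. nrm (Z j) (G j y) \<le> (2 + \<epsilon>) * M * nrm E y) \<and>
           (\<forall>y\<in>carrier E. (\<lambda>j. nrm (Z j) (G j y)) \<longlonglongrightarrow> 0)"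
proof -
  define C where "C = (2 + \<epsilon>) * M"
  have C: "C \<ge> 0" "M \<le> C" using \<open>M \<ge> 0\<close> \<open>\<epsilon> > 0\<close> by (auto simp: C_def algebra_simps)
  have nZ: "normed_vector_space (Z j)" for j using SEP[of j] by (simp add: has_SEP_def banach_space_def)
  note Vin = closed_subspace_in[OF V]
  obtain d :: "nat \<Rightarrow> 'a" where d: "range d \<subseteq> carrier E"
    "\<And>x e. x \<in> carrier E \<Longrightarrow> e > 0 \<Longrightarrow> \<exists>n. nrm E (x \<ominus> d n) < e"
    using E(2) unfolding separable_iff_nrm by blast
  have dc: "d n \<in> carrier E" for n using d(1) by auto
  obtain W P where P: "\<And>n. projection_mod_compact V (W n) (P n)" and W0: "W 0 = V" "\<And>x. P 0 x = x"
    and dW: "\<And>n. d n \<in> W (Suc n)"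
    and mono: "\<And>m n w. m \<le> n \<Longrightarrow> w \<in> W m \<Longrightarrow> w \<in> W n \<and> P n w = P m w"
    by (erule projection_chain[where d = d, OF V dc])
  define good where "good n j \<longleftrightarrow> (\<forall>w\<in>W n. nrm (Z j) (T j (P n w)) \<le> C * nrm E w)" for n j
  \<comment> \<open>Stage \<open>0\<close> is \<open>V\<close> itself, where \<open>T j\<close> has norm at most \<open>M \<le> C\<close>; so \<open>N j\<close> below is a maximum of a nonempty set.\<close>
  have good0: "good 0 j" for j
  proof -
    have "nrm (Z j) (T j w) \<le> C * nrm E w" if "w \<in> V" for w
      using bound[OF that, of j] mult_right_mono[OF C(2) nrm_nonneg[OF Vin[OF that]]] by linarith
    then show ?thesis by (simp add: good_def W0)
  qed
  have eventually_good: "\<forall>\<^sub>F j in sequentially. good n j" for n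
    unfolding good_def C_def
    by (rule eventually_compose_projection_bound[OF P nZ T bound null \<open>M \<ge> 0\<close> \<open>\<epsilon> > 0\<close>])
  define N where "N j = Max {n. n \<le> j \<and> good n j}" for j
  have "N j \<in> {n. n \<le> j \<and> good n j}" for j
    unfolding N_def using good0 by (intro Max_in) auto
  then have goodN: "good (N j) j" for j by simp
  have N_ge: "m \<le> N j" if "m \<le> j" "good m j" for m j
    unfolding N_def using that by (intro Max_ge) auto
  have "\<exists>G. linear_between E (Z j) G \<and> (\<forall>w\<in>W (N j). G w = T j (P (N j) w)) \<and>
            (\<forall>y\<in>carrier E. nrm (Z j) (G y) \<le> C * nrm E y)" for j
  proof (rule has_SEP_1_extend[OF SEP E projection_mod_compact_dom[OF P] _ C(1)])
    note PV = projection_mod_compact_in[OF P[of "N j"]]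
    show "linear_between (E\<lparr>carrier := W (N j)\<rparr>) (Z j) (\<lambda>w. T j (P (N j) w))"
      unfolding linear_between_def
      using PV linear_between_closed[OF T] linear_between_add[OF T] linear_between_smult[OF T]
      by (auto simp: projection_mod_compact_add[OF P] projection_mod_compact_smult[OF P])
    show "nrm (Z j) (T j (P (N j) w)) \<le> C * nrm E w" if "w \<in> W (N j)" for w
      using goodN[of j] that by (simp add: good_def)
  qed
  then obtain G where G: "\<And>j. linear_between E (Z j) (G j)"
      "\<And>j w. w \<in> W (N j) \<Longrightarrow> G j w = T j (P (N j) w)"
      "\<And>j y. y \<in> carrier E \<Longrightarrow> nrm (Z j) (G j y) \<le> C * nrm E y"
    by metis
  have "G j x = T j x" if "x \<in> V" for j x
    using mono[of 0 "N j" x] that by (simp add: G(2) W0)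
  moreover have "(\<lambda>j. nrm (Z j) (G j y)) \<longlonglongrightarrow> 0" if y: "y \<in> carrier E" for y
  proof (rule tendstoI)
    fix e :: real assume e: "e > 0"
    \<comment> \<open>The denominator is \<open>C + 1\<close> because \<open>C\<close> can be \<open>0\<close>.\<close>
    then have "e / (2 * (C + 1)) > 0" using C(1) by simp
    then obtain m where m: "nrm E (y \<ominus> d m) < e / (2 * (C + 1))" using d(2)[OF y] by blast
    define x where "x = P (Suc m) (d m)"
    have "x \<in> V" unfolding x_def by (rule projection_mod_compact_in[OF P dW])
    have "\<forall>\<^sub>F j in sequentially. nrm (Z j) (T j x) < e / 2"
      using order_tendstoD(2)[OF null[OF \<open>x \<in> V\<close>], of "e / 2"] e by simp
    then show "\<forall>\<^sub>F j in sequentially. dist (nrm (Z j) (G j y)) 0 < e"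
      using eventually_good[of "Suc m"] eventually_ge_at_top[of "Suc m"]
    proof eventually_elim
      case (elim j)
      have Gc: "G j u \<in> carrier (Z j)" if "u \<in> carrier E" for u
        by (rule linear_between_closed[OF G(1) that])
      have "Suc m \<le> N j" using N_ge elim by blast
      then have "G j (d m) = T j x"
        using mono[OF \<open>Suc m \<le> N j\<close> dW] G(2)[of "d m" j] by (simp only: x_def)
      then have "nrm (Z j) (G j (d m)) < e / 2"
        using elim by simp
      moreover have "nrm (Z j) (G j y \<ominus>\<^bsub>Z j\<^esub> G j (d m)) \<le> C * nrm E (y \<ominus> d m)"
        using G(3)[of "y \<ominus> d m" j] y dc[of m]
          linear_between_diff[OF normed_vector_space_axioms nZ G(1) y dc, of j m] by simp
      moreover have "C * nrm E (y \<ominus> d m) \<le> (C + 1) * (e / (2 * (C + 1)))"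
        using m C(1) y dc by (intro mult_mono) auto
      moreover have "(C + 1) * (e / (2 * (C + 1))) = e / 2" using C(1) by (simp add: field_simps)
      moreover have "nrm (Z j) (G j y) \<le> nrm (Z j) (G j y \<ominus>\<^bsub>Z j\<^esub> G j (d m)) + nrm (Z j) (G j (d m))"
        by (rule normed_vector_space.nrm_le_diff[OF nZ Gc[OF y] Gc[OF dc]])
      ultimately have "nrm (Z j) (G j y) < e" by linarith
      then show ?case using normed_vector_space.nrm_nonneg[OF nZ Gc[OF y]] by simp
    qed
  qed
  ultimately show ?thesis using G(1,3) unfolding C_def by blast
qed

text \<open>
  The coordinates of the given operator form a pointwise null sequence bounded by its norm, and the extensions of
  the coordinates with the bound \<open>(2 + \<epsilon>) M\<close> are the coordinates of the extension.
\<close>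

theorem corollary1p3:
  fixes Z :: "nat \<Rightarrow> ('k::{real_normed_field, euclidean_space}, 'a) normed_module"
    and \<epsilon> :: real
  assumes "\<And>j. has_SEP TYPE(nat \<Rightarrow> real) 1 (Z j)"
    and "\<epsilon> > 0"
  shows "has_SEP TYPE('y) (2 + \<epsilon>) (c0_sum Z)"
  unfolding has_SEP_def
proof (intro conjI allI impI)
  have SEP: "has_SEP TYPE('y) 1 (Z j)" for j by (rule has_SEP_any_type[OF assms(1)])
  have bZ: "banach_space (Z j)" for j using SEP by (simp add: has_SEP_def)
  have nZ: "normed_vector_space (Z j)" for j using bZ by (simp add: banach_space_def)
  show "banach_space (c0_sum Z)" by (rule banach_space_c0_sum[OF bZ])
  have nC: "normed_vector_space (c0_sum Z)" by (rule normed_vector_space_c0_sum[OF nZ])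
  fix Y :: "('k, 'y) normed_module" and V T
  assume "banach_space Y \<and> separable_space (ntopology Y) \<and> closed_subspace V Y \<and>
    bounded_operator (Y\<lparr>carrier := V\<rparr>) (c0_sum Z) T"
  then have Y: "banach_space Y" "separable_space (ntopology Y)" and V: "closed_subspace V Y"
    and T: "bounded_operator (Y\<lparr>carrier := V\<rparr>) (c0_sum Z) T" by auto
  have nY: "normed_vector_space Y" using Y by (simp add: banach_space_def)
  note nV = normed_vector_space.normed_vector_space_restrict[OF nY V]
  define M where "M = opnorm (Y\<lparr>carrier := V\<rparr>) (c0_sum Z) T"
  have M: "M \<ge> 0" unfolding M_def by (rule opnorm_nonneg[OF nV nC T])
  have lin: "linear_between (Y\<lparr>carrier := V\<rparr>) (c0_sum Z) T"
    using T by (simp add: bounded_operator_iff_linear)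
  have Tc: "T x \<in> carrier (c0_sum Z)" if "x \<in> V" for x
    using linear_between_closed[OF lin] that by simp
  have lin_j: "linear_between (Y\<lparr>carrier := V\<rparr>) (Z j) (\<lambda>x. T x j)" for j
    using lin unfolding linear_between_def by (auto simp: Pi_iff)
  have bound_j: "nrm (Z j) (T x j) \<le> M * nrm Y x" if "x \<in> V" for j x
    using nrm_coord_le_c0_sum[OF Tc[OF that], of j] nrm_le_opnorm[OF nV nC T, of x] that
    by (simp add: M_def del: c0_sum_simps)
  have null_j: "(\<lambda>j. nrm (Z j) (T x j)) \<longlonglongrightarrow> 0" if "x \<in> V" for x
    using Tc[OF that] by simp
  have "\<exists>G. (\<forall>j. linear_between Y (Z j) (G j)) \<and> (\<forall>j. \<forall>x\<in>V. G j x = T x j) \<and>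
      (\<forall>j. \<forall>y\<in>carrier Y. nrm (Z j) (G j y) \<le> (2 + \<epsilon>) * M * nrm Y y) \<and>
      (\<forall>y\<in>carrier Y. (\<lambda>j. nrm (Z j) (G j y)) \<longlonglongrightarrow> 0)"
    by (rule normed_vector_space.extend_null_sequence[OF nY SEP Y V lin_j bound_j null_j M assms(2)])
  then obtain G where G: "\<And>j. linear_between Y (Z j) (G j)"
      "\<And>j x. x \<in> V \<Longrightarrow> G j x = T x j"
      "\<And>j y. y \<in> carrier Y \<Longrightarrow> nrm (Z j) (G j y) \<le> (2 + \<epsilon>) * M * nrm Y y"
      "\<And>y. y \<in> carrier Y \<Longrightarrow> (\<lambda>j. nrm (Z j) (G j y)) \<longlonglongrightarrow> 0"
    by blast
  define T' where "T' y = (\<lambda>j. G j y)" for y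
  have le: "nrm (c0_sum Z) (T' y) \<le> (2 + \<epsilon>) * M * nrm Y y" if "y \<in> carrier Y" for y
    by (rule nrm_c0_sum_le) (simp add: T'_def G(3)[OF that])
  have "linear_between Y (c0_sum Z) T'"
    unfolding linear_between_def T'_def
    using G(4) linear_between_closed[OF G(1)] linear_between_add[OF G(1)] linear_between_smult[OF G(1)]
    by auto
  then have "bounded_operator Y (c0_sum Z) T'"
    using le unfolding bounded_operator_iff_linear by blast
  moreover have "opnorm Y (c0_sum Z) T' \<le> (2 + \<epsilon>) * M"
    using M assms(2) by (intro opnorm_le[OF nY _ le]) auto
  ultimately show "\<exists>T'. bounded_operator Y (c0_sum Z) T' \<and> (\<forall>x\<in>V. T' x = T x) \<and>
      opnorm Y (c0_sum Z) T' \<le> (2 + \<epsilon>) * opnorm (Y\<lparr>carrier := V\<rparr>) (c0_sum Z) T"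
    using G(2) by (intro exI[of _ T']) (auto simp: T'_def M_def)
qed

end
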